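(* Let $n\in\mathbb{Z}_{>0}$, let $k\in\mathbb{Z}_{\ge0}$, and let $V$ be a complex vector space with basis $v_1,\ldots,v_n$. Let $\{x_d\mid d\in A_k\}$ be the basis of $\mathbb{C}A_k(n)$ (and similarly $\{x_d\mid d\in A_{k+\frac12}\}$ the basis of $\mathbb{C}A_{k+\frac12}(n)$) defined in the context. (a) The map $\Phi_k:\mathbb{C}A_k(n)\to\mathrm{End}(V^{\otimes k})$ has $$\mathrm{im}\,\Phi_k=\mathrm{End}_{S_n}(V^{\otimes k})\quad\text{and}\quad\ker\Phi_k=\mathbb{C}\text{-span}\{x_d\mid d\in A_k \text{ has more than } n \text{ blocks}\}.$$ (b) The map $\Phi_{k+\frac12}:\mathbb{C}A_{k+\frac12}(n)\to\mathrm{End}(V^{\otimes k})$ has $$\mathrm{im}\,\Phi_{k+\frac12}=\mathrm{End}_{S_{n-1}}(V^{\otimes k})\quad\text{and}\quad\ker\Phi_{k+\frac12}=\mathbb{C}\text{-span}\{x_d\mid d\in A_{k+\frac12}\text{ has more than } n \text{ blocks}\}.$$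
   Context: For an integer $k\ge0$, $A_k$ is the set of set partitions of $\{1,\ldots,k,1',\ldots,k'\}$, and $A_{k+\frac12}$ is the set of $d\in A_{k+1}$ in which $k+1$ and $(k+1)'$ are in the same block. The partition algebra $\mathbb{C}A_k(n)$ (resp. $\mathbb{C}A_{k+\frac12}(n)$) is the algebra with basis $A_k$ (resp. $A_{k+\frac12}$) and product $d_1d_2=n^\ell(d_1\circ d_2)$, where $d_1\circ d_2$ is obtained by stacking $d_1$ above $d_2$, identifying the bottom (primed) vertices of $d_1$ with the top (unprimed) vertices of $d_2$, and removing the $\ell$ connected components lying entirely in the middle row. The elements $x_d$ are uniquely determined by the relations $d=\sum_{d'}x_{d'}$ for all $d$, the sum being over all $d'$ in $A_k$ (resp. $A_{k+\frac12}$) that are equal to or coarser than $d$ (every block of $d$ is contained in a block of $d'$). For $d\in A_k$ and $i_1,\ldots,i_k,i_{1'},\ldots,i_{k'}\in\{1,\ldots,n\}$ let $(d)^{i_1,\ldots,i_k}_{i_{1'},\ldots,i_{k'}}=1$ if $i_r=i_s$ whenever $r$ and $s$ are in the same block of $d$, and $0$ otherwise. $\Phi_k$ is the linear map with $$\Phi_k(d)(v_{i_1}\otimes\cdots\otimes v_{i_k})=\sum_{1\le i_{1'},\ldots,i_{k'}\le n}(d)^{i_1,\ldots,i_k}_{i_{1'},\ldots,i_{k'}}\,v_{i_{1'}}\otimes\cdots\otimes v_{i_{k'}} .$$ For $d\in A_{k+\frac12}\subseteq A_{k+1}$ the operator $\Phi_{k+1}(d)$ preserves the subspace $V^{\otimes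 k}\otimes v_n\subseteq V^{\otimes(k+1)}$; $\Phi_{k+\frac12}(d)$ is its restriction to this subspace, identified with $V^{\otimes k}$ via $v\otimes v_n\leftrightarrow v$. $S_n$ acts on $V$ by $\sigma v_i=v_{\sigma(i)}$ and diagonally on $V^{\otimes k}$; $S_{n-1}\subseteq S_n$ is the stabilizer of $n$. $\mathrm{End}_G(V^{\otimes k})$ denotes the endomorphisms commuting with $G$. *)

theory Defs
  imports
    "HOL.Vector_Spaces"
    "HOL-Library.Disjoint_Sets"
    "HOL-Library.FuncSet"
    "HOL-Library.Function_Algebras"
    "HOL-Combinatorics.Permutations"
    "HOL-Algebra.Module"
    Complex_Main
begin

text \<open>HOL-Algebra and HOL both have a locale called \<open>module\<close>; the linear algebra below is
  always the one of HOL (\<open>Modules\<close>, \<open>Vector_Spaces\<close>), HOL-Algebra only provides the record type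
  of algebras.\<close>

abbreviation lspan :: "(complex \<Rightarrow> 'a \<Rightarrow> 'a) \<Rightarrow> 'a set \<Rightarrow> 'a::ab_group_add set"
  where "lspan \<equiv> Modules.module.span"

abbreviation lmap :: "(complex \<Rightarrow> 'a::ab_group_add \<Rightarrow> 'a) \<Rightarrow> (complex \<Rightarrow> 'b::ab_group_add \<Rightarrow> 'b)
    \<Rightarrow> ('a \<Rightarrow> 'b) \<Rightarrow> bool"
  where "lmap \<equiv> Vector_Spaces.linear"


section \<open>Diagrams\<close>

text \<open>\<open>Top r\<close> is the vertex $r$, and \<open>Bot r\<close> is the vertex $r'$.\<close>

datatype vertex = Top nat | Bot nat

type_synonym diagram = "vertex set set"

definition vertices :: "nat \<Rightarrow> vertex set"
  where "vertices k = Top ` {1..k} \<union> Bot ` {1..k}"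

definition diagrams :: "nat \<Rightarrow> diagram set"
  where "diagrams k = {d. partition_on (vertices k) d}"

text \<open>\<open>half_diagrams k\<close> is $A_{k+1/2}$.\<close>

definition half_diagrams :: "nat \<Rightarrow> diagram set"
  where "half_diagrams k =
    {d \<in> diagrams (Suc k). \<exists>B\<in>d. Top (Suc k) \<in> B \<and> Bot (Suc k) \<in> B}"


section \<open>The partition algebras\<close>

text \<open>Stacking \<open>d1\<close> above \<open>d2\<close> gives a graph on three rows of vertices, in which the bottom row
  of \<open>d1\<close> and the top row of \<open>d2\<close> have become the middle row.\<close>

datatype stacked_vertex = Upper nat | Middle nat | Lower nat

primrec place_above :: "vertex \<Rightarrow> stacked_vertex" where
  "place_above (Top r) = Upper r"
| "place_above (Bot r) = Middle r"

primrec place_below :: "vertex \<Rightarrow> stacked_vertex" where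
  "place_below (Top r) = Middle r"
| "place_below (Bot r) = Lower r"

primrec place_outer :: "vertex \<Rightarrow> stacked_vertex" where
  "place_outer (Top r) = Upper r"
| "place_outer (Bot r) = Lower r"

definition stacked_components :: "diagram \<Rightarrow> diagram \<Rightarrow> stacked_vertex set set"
  where "stacked_components d1 d2 =
    (let E = image place_above ` d1 \<union> image place_below ` d2
     in \<Union>E // {(p, q). \<exists>B\<in>E. p \<in> B \<and> q \<in> B}\<^sup>+)"

definition diagram_comp :: "diagram \<Rightarrow> diagram \<Rightarrow> diagram"
  where "diagram_comp d1 d2 = (\<lambda>C. place_outer -` C) ` stacked_components d1 d2 - {{}}"

definition middle_components :: "diagram \<Rightarrow> diagram \<Rightarrow> nat"
  where "middle_components d1 d2 = card {C \<in> stacked_components d1 d2. C \<subseteq> range Middle}"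

definition diagram_one :: "nat \<Rightarrow> diagram"
  where "diagram_one k = (\<lambda>r. {Top r, Bot r}) ` {1..k}"

text \<open>Formal linear combinations of diagrams are functions \<open>diagram \<Rightarrow> complex\<close>; they are added
  pointwise.\<close>

definition single :: "diagram \<Rightarrow> diagram \<Rightarrow> complex"
  where "single d = (\<lambda>d'. if d' = d then 1 else 0)"

definition diagram_scale :: "complex \<Rightarrow> (diagram \<Rightarrow> complex) \<Rightarrow> diagram \<Rightarrow> complex"
  where "diagram_scale c a = (\<lambda>d. c * a d)"

text \<open>The algebra with basis \<open>D\<close>, a set of diagrams with \<open>k\<close> vertices in each row, and
  parameter \<open>n\<close>.\<close>

definition diagram_algebra ::
    "nat \<Rightarrow> diagram set \<Rightarrow> nat \<Rightarrow> (complex, diagram \<Rightarrow> complex) module"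
  where "diagram_algebra k D n =
    \<lparr> carrier = {a. \<forall>d. d \<notin> D \<longrightarrow> a d = 0},
      monoid.mult = (\<lambda>a b. \<Sum>d1\<in>D. \<Sum>d2\<in>D.
        diagram_scale (a d1 * b d2 * of_nat n ^ middle_components d1 d2)
          (single (diagram_comp d1 d2))),
      one = single (diagram_one k),
      ring.zero = 0,
      add = (+),
      smult = diagram_scale \<rparr>"

text \<open>$\mathbb{C}A_k(n)$ and $\mathbb{C}A_{k+1/2}(n)$.\<close>

definition partition_algebra :: "nat \<Rightarrow> nat \<Rightarrow> (complex, diagram \<Rightarrow> complex) module"
  where "partition_algebra k n = diagram_algebra k (diagrams k) n"

definition half_partition_algebra :: "nat \<Rightarrow> nat \<Rightarrow> (complex, diagram \<Rightarrow> complex) module"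
  where "half_partition_algebra k n = diagram_algebra (Suc k) (half_diagrams k) n"


section \<open>The elements $x_d$\<close>

text \<open>\<open>D\<close> is a set of diagrams with \<open>k\<close> vertices in each row.  The value outside \<open>D\<close> is fixed only
  to make the family unique as a function; see \<open>orbit_element_sum\<close> and \<open>orbit_element_unique\<close>.\<close>

definition is_orbit_family :: "nat \<Rightarrow> diagram set \<Rightarrow> (diagram \<Rightarrow> diagram \<Rightarrow> complex) \<Rightarrow> bool"
  where "is_orbit_family k D x \<longleftrightarrow>
    (\<forall>d\<in>D. single d = (\<Sum>d' | d' \<in> D \<and> refines (vertices k) d d'. x d')) \<and>
    (\<forall>d. d \<notin> D \<longrightarrow> x d = 0)"

definition orbit_element :: "nat \<Rightarrow> diagram set \<Rightarrow> diagram \<Rightarrow> diagram \<Rightarrow> complex"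
  where "orbit_element k D = (THE x. is_orbit_family k D x)"

lemma finite_diagrams: "finite (diagrams k)"
proof -
  have "diagrams k \<subseteq> Pow (Pow (vertices k))"
    by (auto simp: diagrams_def partition_on_def)
  moreover have "finite (vertices k)" by (simp add: vertices_def)
  ultimately show ?thesis by (meson finite_Pow_iff finite_subset)
qed

lemma ex1_orbit_family:
  assumes D: "D \<subseteq> diagrams k"
  shows "\<exists>!x. is_orbit_family k D x"
proof -
  define R where
    "R = {(d', d). d' \<in> D \<and> d \<in> D \<and> refines (vertices k) d d' \<and> d' \<noteq> d}"
  have finD: "finite D" using D finite_diagrams finite_subset by blast
  have "R \<subseteq> D \<times> D" by (auto simp: R_def)
  then have "finite R" by (rule finite_subset) (simp add: finD)
  moreover have "trans R"
    unfolding R_def by (rule transI) (auto dest: refines_trans refines_asym)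
  then have "acyclic R" by (auto simp: acyclic_def R_def trancl_id)
  ultimately have wf: "wf R" by (rule finite_acyclic_wf)
  have split: "(\<Sum>d' | d' \<in> D \<and> refines (vertices k) d d'. x d') = x d + (\<Sum>d' | (d', d) \<in> R. x d')"
    if d: "d \<in> D" for d and x :: "diagram \<Rightarrow> diagram \<Rightarrow> complex"
  proof -
    have "refines (vertices k) d d"
      using d D by (auto simp: diagrams_def intro: refines_refl)
    then have "{d'. d' \<in> D \<and> refines (vertices k) d d'} = insert d {d'. (d', d) \<in> R}"
      using d by (auto simp: R_def)
    moreover have "finite {d'. (d', d) \<in> R}"
      by (rule finite_subset[OF _ finD]) (auto simp: R_def)
    ultimately show ?thesis by (simp add: R_def)
  qed
  have iff: "is_orbit_family k D x \<longleftrightarrow>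
      (\<forall>d. x d = (if d \<in> D then single d - (\<Sum>d' | (d', d) \<in> R. x d') else 0))" for x
    unfolding is_orbit_family_def by (auto simp: split eq_diff_eq)
  have "\<exists>x. \<forall>d. x d = (if d \<in> D then single d - (\<Sum>d' | (d', d) \<in> R. x d') else 0)"
  proof (rule dependent_wf_choice[OF wf])
    fix f g :: "diagram \<Rightarrow> diagram \<Rightarrow> complex" and d r
    assume "\<And>z. (z, d) \<in> R \<Longrightarrow> f z = g z"
    then have "(\<Sum>d' | (d', d) \<in> R. f d') = (\<Sum>d' | (d', d) \<in> R. g d')"
      by (intro sum.cong) auto
    then show "(r = (if d \<in> D then single d - (\<Sum>d' | (d', d) \<in> R. f d') else 0)) =
        (r = (if d \<in> D then single d - (\<Sum>d' | (d', d) \<in> R. g d') else 0))"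
      by simp
  qed simp
  then obtain x where x: "is_orbit_family k D x" using iff by blast
  have "y = x" if y: "is_orbit_family k D y" for y
  proof
    fix d
    show "y d = x d"
      using wf
    proof (induction d rule: wf_induct_rule)
      case (less d)
      then have "(\<Sum>d' | (d', d) \<in> R. y d') = (\<Sum>d' | (d', d) \<in> R. x d')"
        by (intro sum.cong) auto
      moreover have "y d = (if d \<in> D then single d - (\<Sum>d' | (d', d) \<in> R. y d') else 0)"
        using y unfolding iff by blast
      moreover have "x d = (if d \<in> D then single d - (\<Sum>d' | (d', d) \<in> R. x d') else 0)"
        using x unfolding iff by blast
      ultimately show ?case by (simp only:)
    qed
  qed
  with x show ?thesis by blast
qed

lemma half_diagrams_subset: "half_diagrams k \<subseteq> diagrams (Suc k)"
  by (auto simp: half_diagrams_def)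

lemma orbit_element_sum:
  assumes "D \<subseteq> diagrams k" and "d \<in> D"
  shows "single d = (\<Sum>d' | d' \<in> D \<and> refines (vertices k) d d'. orbit_element k D d')"
  using theI'[OF ex1_orbit_family[OF assms(1)]] assms(2)
  unfolding orbit_element_def is_orbit_family_def by blast

lemma orbit_element_unique:
  assumes "D \<subseteq> diagrams k" and "is_orbit_family k D x"
  shows "orbit_element k D = x"
  using theI'[OF ex1_orbit_family[OF assms(1)]] ex1_orbit_family[OF assms(1)] assms(2)
  unfolding orbit_element_def by blast


section \<open>Tensor powers\<close>

definition is_basis :: "(complex \<Rightarrow> 'v::ab_group_add \<Rightarrow> 'v) \<Rightarrow> nat \<Rightarrow> (nat \<Rightarrow> 'v) \<Rightarrow> bool"
  where "is_basis sV n v \<longleftrightarrow> inj_on v {1..n} \<and>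
    \<not> Modules.module.dependent sV (v ` {1..n}) \<and> lspan sV (v ` {1..n}) = UNIV"

text \<open>A \<open>k\<close>-tuple of vectors is a function on \<open>{1..k}\<close>; values elsewhere are ignored, which is what
  the first conjunct says.\<close>

definition multilinear :: "(complex \<Rightarrow> 'v::ab_group_add \<Rightarrow> 'v) \<Rightarrow> nat
    \<Rightarrow> (complex \<Rightarrow> 'w::ab_group_add \<Rightarrow> 'w) \<Rightarrow> ((nat \<Rightarrow> 'v) \<Rightarrow> 'w) \<Rightarrow> bool"
  where "multilinear sV k sW t \<longleftrightarrow>
    (\<forall>u u'. (\<forall>r\<in>{1..k}. u r = u' r) \<longrightarrow> t u = t u') \<and>
    (\<forall>u. \<forall>r\<in>{1..k}. lmap sV sW (\<lambda>a. t (u(r := a))))"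

text \<open>\<open>'w\<close> with scalar multiplication \<open>sW\<close> is the \<open>k\<close>-th tensor power of \<open>'v\<close>, and \<open>t u\<close> is
  $u_1\otimes\cdots\otimes u_k$.  The universal property is stated for multilinear maps to the
  scalar field, since one cannot quantify over types inside a definition.  For vector spaces this
  implies the universal property for arbitrary targets: uniqueness says that no nonzero linear form
  vanishes on all \<open>t u\<close>, so the \<open>t u\<close> span, and existence, applied to products of coordinate
  forms, says that the tensors of basis vectors are linearly independent.\<close>

definition tensor_power :: "(complex \<Rightarrow> 'v::ab_group_add \<Rightarrow> 'v) \<Rightarrow> nat
    \<Rightarrow> (complex \<Rightarrow> 'w::ab_group_add \<Rightarrow> 'w) \<Rightarrow> ((nat \<Rightarrow> 'v) \<Rightarrow> 'w) \<Rightarrow> bool"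
  where "tensor_power sV k sW t \<longleftrightarrow>
    vector_space sV \<and> vector_space sW \<and> multilinear sV k sW t \<and>
    (\<forall>f. multilinear sV k (*) f \<longrightarrow> (\<exists>!g. lmap sW (*) g \<and> (\<forall>u. g (t u) = f u)))"


section \<open>The action of the symmetric group\<close>

definition perm_act :: "(complex \<Rightarrow> 'v::ab_group_add \<Rightarrow> 'v) \<Rightarrow> nat \<Rightarrow> (nat \<Rightarrow> 'v)
    \<Rightarrow> (nat \<Rightarrow> nat) \<Rightarrow> 'v \<Rightarrow> 'v"
  where "perm_act sV n v \<sigma> = (THE g. lmap sV sV g \<and> (\<forall>i\<in>{1..n}. g (v i) = v (\<sigma> i)))"

definition tensor_act :: "(complex \<Rightarrow> 'v::ab_group_add \<Rightarrow> 'v) \<Rightarrow> nat \<Rightarrow> (nat \<Rightarrow> 'v)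
    \<Rightarrow> (complex \<Rightarrow> 'w::ab_group_add \<Rightarrow> 'w) \<Rightarrow> ((nat \<Rightarrow> 'v) \<Rightarrow> 'w) \<Rightarrow> (nat \<Rightarrow> nat) \<Rightarrow> 'w \<Rightarrow> 'w"
  where "tensor_act sV n v sW t \<sigma> =
    (THE g. lmap sW sW g \<and> (\<forall>u. g (t u) = t (\<lambda>r. perm_act sV n v \<sigma> (u r))))"

definition symm_group :: "nat \<Rightarrow> (nat \<Rightarrow> nat) set"
  where "symm_group n = {\<sigma>. \<sigma> permutes {1..n}}"

definition symm_stabilizer :: "nat \<Rightarrow> (nat \<Rightarrow> nat) set"
  where "symm_stabilizer n = {\<sigma> \<in> symm_group n. \<sigma> n = n}"

text \<open>$\mathrm{End}_G(V^{\otimes k})$ for \<open>G \<subseteq> symm_group n\<close>.\<close>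

definition End_group :: "(complex \<Rightarrow> 'v::ab_group_add \<Rightarrow> 'v) \<Rightarrow> nat \<Rightarrow> (nat \<Rightarrow> 'v)
    \<Rightarrow> (complex \<Rightarrow> 'w::ab_group_add \<Rightarrow> 'w) \<Rightarrow> ((nat \<Rightarrow> 'v) \<Rightarrow> 'w) \<Rightarrow> (nat \<Rightarrow> nat) set \<Rightarrow> ('w \<Rightarrow> 'w) set"
  where "End_group sV n v sW t G =
    {f. lmap sW sW f \<and>
        (\<forall>\<sigma>\<in>G. f \<circ> tensor_act sV n v sW t \<sigma> = tensor_act sV n v sW t \<sigma> \<circ> f)}"


section \<open>The maps $\Phi_k$ and $\Phi_{k+1/2}$\<close>

primrec vertex_label :: "(nat \<Rightarrow> nat) \<Rightarrow> (nat \<Rightarrow> nat) \<Rightarrow> vertex \<Rightarrow> nat" where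
  "vertex_label i j (Top r) = i r"
| "vertex_label i j (Bot r) = j r"

text \<open>The matrix entry $(d)^{i_1,\ldots,i_k}_{i_{1'},\ldots,i_{k'}}$, with \<open>i r\<close> for $i_r$ and
  \<open>j r\<close> for $i_{r'}$.\<close>

definition diagram_entry :: "diagram \<Rightarrow> (nat \<Rightarrow> nat) \<Rightarrow> (nat \<Rightarrow> nat) \<Rightarrow> complex"
  where "diagram_entry d i j =
    (if \<forall>B\<in>d. \<forall>p\<in>B. \<forall>q\<in>B. vertex_label i j p = vertex_label i j q then 1 else 0)"

definition multi_indices :: "nat \<Rightarrow> nat \<Rightarrow> (nat \<Rightarrow> nat) set"
  where "multi_indices n k = {1..k} \<rightarrow>\<^sub>E {1..n}"

definition Phi_diagram :: "nat \<Rightarrow> (nat \<Rightarrow> 'v::ab_group_add) \<Rightarrow> nat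
    \<Rightarrow> (complex \<Rightarrow> 'w::ab_group_add \<Rightarrow> 'w) \<Rightarrow> ((nat \<Rightarrow> 'v) \<Rightarrow> 'w) \<Rightarrow> diagram \<Rightarrow> 'w \<Rightarrow> 'w"
  where "Phi_diagram n v k sW t d =
    (THE f. lmap sW sW f \<and>
      (\<forall>i\<in>multi_indices n k. f (t (\<lambda>r. v (i r))) =
         (\<Sum>j\<in>multi_indices n k. sW (diagram_entry d i j) (t (\<lambda>r. v (j r))))))"

definition Phi :: "nat \<Rightarrow> (nat \<Rightarrow> 'v::ab_group_add) \<Rightarrow> nat
    \<Rightarrow> (complex \<Rightarrow> 'w::ab_group_add \<Rightarrow> 'w) \<Rightarrow> ((nat \<Rightarrow> 'v) \<Rightarrow> 'w) \<Rightarrow> (diagram \<Rightarrow> complex) \<Rightarrow> 'w \<Rightarrow> 'w"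
  where "Phi n v k sW t a = (\<lambda>w. \<Sum>d\<in>diagrams k. sW (a d) (Phi_diagram n v k sW t d w))"

text \<open>From here on \<open>(sW, tW)\<close> is the \<open>k\<close>-th and \<open>(sZ, tZ)\<close> the \<open>(k+1)\<close>-st tensor power.  The map
  \<open>tensor_last\<close> is $w\mapsto w\otimes v_n$; it is injective with range $V^{\otimes k}\otimes v_n$, so
  \<open>inv_into\<close> below undoes the identification of $V^{\otimes k}$ with that subspace.\<close>

definition tensor_last :: "nat \<Rightarrow> (nat \<Rightarrow> 'v::ab_group_add) \<Rightarrow> nat
    \<Rightarrow> (complex \<Rightarrow> 'w::ab_group_add \<Rightarrow> 'w) \<Rightarrow> ((nat \<Rightarrow> 'v) \<Rightarrow> 'w)
    \<Rightarrow> (complex \<Rightarrow> 'z::ab_group_add \<Rightarrow> 'z) \<Rightarrow> ((nat \<Rightarrow> 'v) \<Rightarrow> 'z) \<Rightarrow> 'w \<Rightarrow> 'z"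
  where "tensor_last n v k sW tW sZ tZ =
    (THE h. lmap sW sZ h \<and> (\<forall>u. h (tW u) = tZ (u(Suc k := v n))))"

definition Phi_half_diagram :: "nat \<Rightarrow> (nat \<Rightarrow> 'v::ab_group_add) \<Rightarrow> nat
    \<Rightarrow> (complex \<Rightarrow> 'w::ab_group_add \<Rightarrow> 'w) \<Rightarrow> ((nat \<Rightarrow> 'v) \<Rightarrow> 'w)
    \<Rightarrow> (complex \<Rightarrow> 'z::ab_group_add \<Rightarrow> 'z) \<Rightarrow> ((nat \<Rightarrow> 'v) \<Rightarrow> 'z) \<Rightarrow> diagram \<Rightarrow> 'w \<Rightarrow> 'w"
  where "Phi_half_diagram n v k sW tW sZ tZ d =
    inv_into UNIV (tensor_last n v k sW tW sZ tZ) \<circ> Phi_diagram n v (Suc k) sZ tZ d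
      \<circ> tensor_last n v k sW tW sZ tZ"

definition Phi_half :: "nat \<Rightarrow> (nat \<Rightarrow> 'v::ab_group_add) \<Rightarrow> nat
    \<Rightarrow> (complex \<Rightarrow> 'w::ab_group_add \<Rightarrow> 'w) \<Rightarrow> ((nat \<Rightarrow> 'v) \<Rightarrow> 'w)
    \<Rightarrow> (complex \<Rightarrow> 'z::ab_group_add \<Rightarrow> 'z) \<Rightarrow> ((nat \<Rightarrow> 'v) \<Rightarrow> 'z)
    \<Rightarrow> (diagram \<Rightarrow> complex) \<Rightarrow> 'w \<Rightarrow> 'w"
  where "Phi_half n v k sW tW sZ tZ a =
    (\<lambda>w. \<Sum>d\<in>half_diagrams k. sW (a d) (Phi_half_diagram n v k sW tW sZ tZ d w))"

definition kernel_on :: "('a \<Rightarrow> 'w \<Rightarrow> 'w::zero) \<Rightarrow> ('a, 'm) partial_object_scheme \<Rightarrow> 'a set"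
  where "kernel_on F A = {a \<in> carrier A. F a = (\<lambda>_. 0)}"

end

theory Submission
  imports Defs
begin

text \<open>In the basis of tensors of basis vectors, an endomorphism is a matrix indexed by pairs
  \<open>(i, j)\<close> of multi-indices, and such a pair is a labelling of the \<open>2 * k\<close> vertices by
  \<open>{1..n}\<close>.  Let \<open>\<kappa>\<close> be the partition of the vertices into the sets of equal label.  The diagram
  \<open>d\<close> acts by the matrix with entry 1 where \<open>d\<close> refines \<open>\<kappa>\<close>, so \<open>x\<^sub>d\<close> acts by the indicator of
  \<open>\<kappa> = d\<close>.  The matrices commuting with the symmetric group are those constant on its orbits, and
  two labellings lie in the same orbit iff they have the same \<open>\<kappa>\<close>; this gives the image.  The
  partitions that occur as \<open>\<kappa>\<close> are those with at most \<open>n\<close> blocks; this gives the kernel.  For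
  half-integer diagrams the same argument applies with both multi-indices extended by the value
  \<open>n\<close> in position \<open>k + 1\<close>.\<close>

section \<open>Linear maps in coordinates\<close>

text \<open>A finite basis presented through its coordinate forms, so that linear algebra reduces to
  finite sums. The index set is arbitrary because both \<open>{1..n}\<close> and the set of
  multi-indices will serve.\<close>

locale dual_basis = vector_space scale
  for scale :: "'f::field \<Rightarrow> 'w \<Rightarrow> 'w::ab_group_add" (infixr \<open>*s\<close> 75) +
  fixes I :: "'i set" and e :: "'i \<Rightarrow> 'w" and c :: "'i \<Rightarrow> 'w \<Rightarrow> 'f"
  assumes finite_index: "finite I"
    and coord_linear: "i \<in> I \<Longrightarrow> Vector_Spaces.linear scale (*) (c i)"
    and coord_basis: "i \<in> I \<Longrightarrow> j \<in> I \<Longrightarrow> c i (e j) = (if i = j then 1 else 0)"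
    and expansion: "(\<Sum>i\<in>I. c i w *s e i) = w"
begin

lemma linear_eqI:
  assumes f: "Vector_Spaces.linear scale scale' f" and g: "Vector_Spaces.linear scale scale' g"
    and eq: "\<And>i. i \<in> I \<Longrightarrow> f (e i) = g (e i)"
  shows "f = g"
proof
  fix w
  interpret f: Vector_Spaces.linear scale scale' f by fact
  interpret g: Vector_Spaces.linear scale scale' g by fact
  have "f (\<Sum>i\<in>I. c i w *s e i) = g (\<Sum>i\<in>I. c i w *s e i)"
    by (simp add: f.sum g.sum f.scale g.scale eq)
  then show "f w = g w" by (simp add: expansion)
qed

text \<open>Shaped to match the \<open>THE\<close> descriptions of \<open>operator\<close> and
  \<open>perm_act\<close>. The map sends \<open>w\<close> to the combination of the
  \<open>b i\<close> with the coordinates of \<open>w\<close>.\<close>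

lemma ex1_linear:
  fixes scale' :: "'f \<Rightarrow> 'x \<Rightarrow> 'x::ab_group_add"
  assumes "vector_space scale'"
  shows "\<exists>!f. Vector_Spaces.linear scale scale' f \<and> (\<forall>i\<in>I. f (e i) = b i)"
proof -
  interpret V: vector_space scale' by fact
  let ?f = "\<lambda>w. \<Sum>i\<in>I. scale' (c i w) (b i)"
  have "Vector_Spaces.linear scale scale' ?f"
    unfolding Vector_Spaces.linear_iff
  proof (intro conjI allI vector_space_axioms assms)
    fix x y :: 'w and a :: 'f
    show "?f (x + y) = ?f x + ?f y"
      unfolding sum.distrib[symmetric] using coord_linear
      by (intro sum.cong) (auto simp: Vector_Spaces.linear_iff V.scale_left_distrib)
    show "?f (a *s x) = scale' a (?f x)"
      unfolding V.scale_sum_right using coord_linear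
      by (intro sum.cong) (auto simp: Vector_Spaces.linear_iff)
  qed
  moreover have "?f (e i) = b i" if "i \<in> I" for i
  proof -
    have "?f (e i) = (\<Sum>j\<in>I. if j = i then b i else 0)"
      using that by (intro sum.cong) (auto simp: coord_basis)
    then show ?thesis using that by (simp add: finite_index)
  qed
  ultimately show ?thesis using linear_eqI[of scale'] by (intro ex1I[of _ ?f]) auto
qed

text \<open>The image of \<open>e i\<close> is read off row \<open>i\<close> of \<open>M\<close>,
  the transpose of the usual convention. This agrees with \<open>Phi_diagram\<close>, whose
  description is the same with \<open>diagram_entry d\<close> as \<open>M\<close>.\<close>

definition operator :: "('i \<Rightarrow> 'i \<Rightarrow> 'f) \<Rightarrow> 'w \<Rightarrow> 'w"
  where "operator M = (THE f. Vector_Spaces.linear scale scale f \<and>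
    (\<forall>i\<in>I. f (e i) = (\<Sum>j\<in>I. M i j *s e j)))"

lemma operator_linear: "Vector_Spaces.linear scale scale (operator M)"
  and operator_basis: "i \<in> I \<Longrightarrow> operator M (e i) = (\<Sum>j\<in>I. M i j *s e j)"
  using theI'[OF ex1_linear[OF vector_space_axioms, of "\<lambda>i. \<Sum>j\<in>I. M i j *s e j"]]
  unfolding operator_def by auto

lemma operator_eqI:
  assumes "Vector_Spaces.linear scale scale f"
    and "\<And>i. i \<in> I \<Longrightarrow> f (e i) = (\<Sum>j\<in>I. M i j *s e j)"
  shows "f = operator M"
  using assms by (intro linear_eqI[of scale] operator_linear) (auto simp: operator_basis)

lemma coord_sum:
  assumes "i \<in> I"
  shows "c i (\<Sum>j\<in>I. m j *s e j) = m i"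
proof -
  interpret c: Vector_Spaces.linear scale "(*)" "c i" using assms by (rule coord_linear)
  have "c i (\<Sum>j\<in>I. m j *s e j) = (\<Sum>j\<in>I. if j = i then m i else 0)"
    unfolding c.sum using assms by (intro sum.cong) (auto simp: c.scale coord_basis)
  then show ?thesis using assms by (simp add: finite_index)
qed

lemma operator_eq_iff: "operator M = operator N \<longleftrightarrow> (\<forall>i\<in>I. \<forall>j\<in>I. M i j = N i j)"
proof
  assume eq: "operator M = operator N"
  show "\<forall>i\<in>I. \<forall>j\<in>I. M i j = N i j"
  proof (intro ballI)
    fix i j assume "i \<in> I" "j \<in> I"
    with eq have "c j (\<Sum>j\<in>I. M i j *s e j) = c j (\<Sum>j\<in>I. N i j *s e j)"
      by (simp flip: operator_basis)
    with \<open>j \<in> I\<close> show "M i j = N i j" by (simp add: coord_sum)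
  qed
qed (auto intro!: operator_eqI operator_linear sum.cong simp: operator_basis)

lemma linear_is_operator:
  assumes "Vector_Spaces.linear scale scale f"
  shows "f = operator (\<lambda>i j. c j (f (e i)))"
  using assms by (intro operator_eqI) (auto simp: expansion)

lemma sum_operator:
  "(\<lambda>w. \<Sum>d\<in>D. a d *s operator (M d) w) = operator (\<lambda>i j. \<Sum>d\<in>D. a d * M d i j)"
proof (rule operator_eqI)
  show "Vector_Spaces.linear scale scale (\<lambda>w. \<Sum>d\<in>D. a d *s operator (M d) w)"
    using operator_linear
    by (simp add: Vector_Spaces.linear_iff scale_right_distrib sum.distrib scale_sum_right mult.commute)
  fix i assume "i \<in> I"
  then show "(\<Sum>d\<in>D. a d *s operator (M d) (e i)) = (\<Sum>j\<in>I. (\<Sum>d\<in>D. a d * M d i j) *s e j)"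
    by (simp add: operator_basis scale_sum_right scale_sum_left sum.swap[of _ D])
qed

lemma operator_eq_0_iff: "operator M = (\<lambda>_. 0) \<longleftrightarrow> (\<forall>i\<in>I. \<forall>j\<in>I. M i j = 0)"
proof -
  have "(\<lambda>_. 0) = operator (\<lambda>_ _. 0)"
    by (rule operator_eqI) (auto simp: Vector_Spaces.linear_iff vector_space_axioms)
  then show ?thesis by (simp add: operator_eq_iff)
qed

text \<open>With \<open>q\<close> the inverse of \<open>p\<close> on \<open>I\<close>, precomposing
  with \<open>g\<close> turns the entry at \<open>(i, j)\<close> into \<open>M (p i) j\<close>, and
  postcomposing turns it into \<open>M i (q j)\<close>. Substituting \<open>p j\<close> for
  \<open>j\<close> gives the invariance of \<open>M\<close>.\<close>

lemma operator_commute_iff: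
  assumes g: "Vector_Spaces.linear scale scale g"
    and g_basis: "\<And>i. i \<in> I \<Longrightarrow> g (e i) = e (p i)"
    and p: "bij_betw p I I"
  shows "operator M \<circ> g = g \<circ> operator M \<longleftrightarrow> (\<forall>i\<in>I. \<forall>j\<in>I. M (p i) (p j) = M i j)"
proof -
  interpret g: Vector_Spaces.linear scale scale g by fact
  define q where "q = inv_into I p"
  have pI: "p i \<in> I" and qI: "q i \<in> I" and qp: "q (p i) = i" and pq: "p (q i) = i"
    if "i \<in> I" for i
    using p that unfolding q_def
    by (auto simp: bij_betw_apply bij_betw_inv_into_left bij_betw_inv_into_right
        intro: bij_betw_apply[OF bij_betw_inv_into])
  have "operator M \<circ> g = operator (\<lambda>i. M (p i))"
    using pI by (intro operator_eqI Vector_Spaces.linear_compose[OF g operator_linear])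
      (auto simp: g_basis operator_basis)
  moreover have "g \<circ> operator M = operator (\<lambda>i j. M i (q j))"
  proof (intro operator_eqI Vector_Spaces.linear_compose[OF operator_linear g])
    fix i assume "i \<in> I"
    then have "(g \<circ> operator M) (e i) = (\<Sum>j\<in>I. M i (q (p j)) *s e (p j))"
      by (auto simp: operator_basis g.sum g.scale g_basis qp intro!: sum.cong)
    also have "\<dots> = (\<Sum>j\<in>I. M i (q j) *s e j)"
      by (rule sum.reindex_bij_betw[OF p])
    finally show "(g \<circ> operator M) (e i) = (\<Sum>j\<in>I. M i (q j) *s e j)" .
  qed
  ultimately have "operator M \<circ> g = g \<circ> operator M \<longleftrightarrow> (\<forall>i\<in>I. \<forall>j\<in>I. M (p i) j = M i (q j))"
    by (simp add: operator_eq_iff)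
  also have "\<dots> \<longleftrightarrow> (\<forall>i\<in>I. \<forall>j\<in>I. M (p i) (p j) = M i j)"
    by (metis pI qI qp pq)
  finally show ?thesis .
qed

end


section \<open>Tensor powers in coordinates\<close>

lemma vector_space_times: "vector_space ((*) :: 'f::field \<Rightarrow> 'f \<Rightarrow> 'f)"
  by unfold_locales (auto simp: algebra_simps)

lemma is_basis_dual_basis:
  assumes V: "vector_space sV" and "is_basis sV n v"
  obtains c where "dual_basis sV {1..n} v c"
proof -
  interpret V: vector_space sV by fact
  let ?B = "v ` {1..n}"
  have inj: "inj_on v {1..n}" and ind: "V.independent ?B" and span: "V.span ?B = UNIV"
    using assms(2) by (auto simp: is_basis_def)
  have "dual_basis sV {1..n} v (\<lambda>i x. V.representation ?B x (v i))"
  proof (intro dual_basis.intro dual_basis_axioms.intro V.vector_space_axioms)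
    show "Vector_Spaces.linear sV (*) (\<lambda>x. V.representation ?B x (v i))" for i
      using ind span by (rule V.linear_representation)
  next
    fix i j assume "i \<in> {1..n}" "j \<in> {1..n}"
    then show "V.representation ?B (v j) (v i) = (if i = j then 1 else 0)"
      using V.representation_basis[OF ind, of "v j"] inj \<open>i \<in> {1..n}\<close> by (auto dest: inj_onD)
  next
    fix x
    have "(\<Sum>b\<in>?B. sV (V.representation ?B x b) b) = x"
      using ind span by (intro V.sum_representation_eq) auto
    then show "(\<Sum>i\<in>{1..n}. sV (V.representation ?B x (v i)) (v i)) = x"
      by (subst (asm) sum.reindex[OF inj]) simp
  qed auto
  then show ?thesis by (rule that)
qed

section \<open>Multilinear maps\<close>

lemma multilinear_cong: "multilinear sV k sW t \<Longrightarrow> (\<And>r. r \<in> {1..k} \<Longrightarrow> u r = u' r) \<Longrightarrow> t u = t u'"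
  by (simp add: multilinear_def)

lemma multilinear_compose:
  assumes "multilinear sV k sW t" and "lmap sW sX h"
  shows "multilinear sV k sX (\<lambda>u. h (t u))"
proof -
  have "lmap sV sX (\<lambda>a. h (t (u(r := a))))" if "r \<in> {1..k}" for u r
    using Vector_Spaces.linear_compose[of sV sW "\<lambda>a. t (u(r := a))" sX h] assms that
    by (simp add: multilinear_def o_def)
  moreover have "h (t u) = h (t u')" if "\<forall>r\<in>{1..k}. u r = u' r" for u u'
    using multilinear_cong[OF assms(1)] that by metis
  ultimately show ?thesis by (simp add: multilinear_def)
qed

lemma multilinear_map_args:
  assumes t: "multilinear sV k sW t" and g: "lmap sV sV g"
  shows "multilinear sV k sW (\<lambda>u. t (\<lambda>r. g (u r)))"
proof -
  have "lmap sV sW (\<lambda>a. t (\<lambda>r. g ((u(r' := a)) r)))" if "r' \<in> {1..k}" for u r'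
  proof -
    have "(\<lambda>r. g ((u(r' := a)) r)) = (\<lambda>r. g (u r))(r' := g a)" for a by auto
    moreover have "lmap sV sW (\<lambda>a. t ((\<lambda>r. g (u r))(r' := a)))"
      using t that by (simp add: multilinear_def)
    ultimately show ?thesis using Vector_Spaces.linear_compose[OF g] by (simp add: o_def)
  qed
  with t show ?thesis unfolding multilinear_def by simp
qed

text \<open>Putting \<open>v n\<close> into the last slot of the larger tensor power yields the
  multilinear map that \<open>tensor_last\<close> linearises.\<close>

lemma multilinear_fix_last:
  assumes "multilinear sV (Suc k) sZ t"
  shows "multilinear sV k sZ (\<lambda>u. t (u(Suc k := x)))"
proof -
  have "lmap sV sZ (\<lambda>a. t (u(r := a, Suc k := x)))" if "r \<in> {1..k}" for u r
    using assms that unfolding multilinear_def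
    by (subst fun_upd_twist) auto
  with assms show ?thesis unfolding multilinear_def by simp
qed

text \<open>Products of coordinate forms of the base space will induce the coordinate forms of the
  tensor power.\<close>

lemma multilinear_prod:
  assumes "vector_space sV" and "\<And>r. r \<in> {1..k} \<Longrightarrow> lmap sV (*) (\<phi> r)"
  shows "multilinear sV k (*) (\<lambda>u. \<Prod>r\<in>{1..k}. \<phi> r (u r))"
proof -
  have "lmap sV (*) (\<lambda>a. \<Prod>r\<in>{1..k}. \<phi> r ((u(r' := a)) r))" if "r' \<in> {1..k}" for u r'
  proof -
    have "(\<Prod>r\<in>{1..k}. \<phi> r ((u(r' := a)) r)) = \<phi> r' a * (\<Prod>r\<in>{1..k} - {r'}. \<phi> r (u r))" for a
      using that by (subst prod.remove[of _ r']) (auto intro!: prod.cong)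
    then show ?thesis using assms(2)[OF that]
      by (simp add: Vector_Spaces.linear_iff algebra_simps)
  qed
  then show ?thesis unfolding multilinear_def by (auto intro!: prod.cong)
qed

lemma multilinear_eqI:
  assumes V: "dual_basis sV {1..n} v c"
    and f: "multilinear sV k sX f" and g: "multilinear sV k sX g"
    and eq: "\<And>i. i \<in> multi_indices n k \<Longrightarrow> f (\<lambda>r. v (i r)) = g (\<lambda>r. v (i r))"
  shows "f = g"
proof -
  interpret dual_basis sV "{1..n}" v c by fact
  \<comment> \<open>Slots up to \<open>m\<close> are arbitrary and the later ones hold basis
    vectors. The induction frees one slot at a time; at \<open>m = k\<close> no condition is
    left.\<close>
  have "f u = g u" if "m \<le> k" "\<And>r. r \<in> {m<..k} \<Longrightarrow> u r \<in> v ` {1..n}" for m u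
    using that
  proof (induction m arbitrary: u)
    case 0
    define i where "i r = inv_into {1..n} v (u r)" for r
    have i: "i r \<in> {1..n}" "u r = v (i r)" if "r \<in> {1..k}" for r
    proof -
      have "u r \<in> v ` {1..n}" using 0 that by simp
      then show "i r \<in> {1..n}" "u r = v (i r)"
        unfolding i_def by (rule inv_into_into, simp add: f_inv_into_f)
    qed
    \<comment> \<open>Multi-indices are extensional, so \<open>i\<close> is restricted; multilinear
      maps ignore values outside \<open>{1..k}\<close>.\<close>
    then have "restrict i {1..k} \<in> multi_indices n k"
      unfolding multi_indices_def by (auto simp del: atLeastAtMost_iff)
    moreover have "f u = f (\<lambda>r. v (restrict i {1..k} r))" "g u = g (\<lambda>r. v (restrict i {1..k} r))"
      using i by (auto intro: multilinear_cong[OF f] multilinear_cong[OF g])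
    ultimately show ?case using eq by metis
  next
    case (Suc m)
    have "(\<lambda>a. f (u(Suc m := a))) = (\<lambda>a. g (u(Suc m := a)))"
    proof (rule linear_eqI[of sX])
      show "lmap sV sX (\<lambda>a. f (u(Suc m := a)))" "lmap sV sX (\<lambda>a. g (u(Suc m := a)))"
        using f g Suc.prems(1) by (auto simp: multilinear_def)
      show "f (u(Suc m := v j)) = g (u(Suc m := v j))" if "j \<in> {1..n}" for j
        using that Suc.prems by (intro Suc.IH) auto
    qed
    from fun_cong[OF this, of "u (Suc m)"] show ?case by simp
  qed
  from this[of k] show ?thesis by auto
qed

text \<open>\<open>tensor_power\<close> speaks only about scalar-valued maps, so vectors of the
  tensor power are compared by linear forms. A nonzero \<open>x - y\<close> is independent, hence
  some form takes the value 1 on it.\<close>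

lemma linear_forms_separate:
  assumes "vector_space sW" and eq: "\<And>h. lmap sW (*) h \<Longrightarrow> h x = h y"
  shows "x = y"
proof (rule ccontr)
  interpret vector_space_pair sW "(*) :: complex \<Rightarrow> complex \<Rightarrow> complex"
    using assms(1) vector_space_times by (rule vector_space_pair.intro)
  assume "x \<noteq> y"
  then have "vs1.independent {x - y}" by simp
  then obtain h where h: "lmap sW (*) h" "h (x - y) = (1 :: complex)"
    using linear_independent_extend[of "{x - y}" "\<lambda>_. 1"] by auto
  interpret h: Vector_Spaces.linear sW "(*)" h by (rule h)
  show False using eq[OF h(1)] h(2) by (simp add: h.diff)
qed

text \<open>The existence half of the universal property supplies the coordinate forms; the
  uniqueness half shows that the basis tensors span.\<close>

lemma tensor_power_dual_basis:
  assumes V: "dual_basis sV {1..n} v c" and T: "tensor_power sV k sW t"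
  obtains C where "dual_basis sW (multi_indices n k) (\<lambda>i. t (\<lambda>r. v (i r))) C"
proof -
  interpret V: dual_basis sV "{1..n}" v c by fact
  interpret W: vector_space sW using T by (simp add: tensor_power_def)
  let ?I = "multi_indices n k"
  have mult: "multilinear sV k sW t" using T by (simp add: tensor_power_def)
  have fin: "finite ?I" by (auto simp: multi_indices_def intro: finite_PiE)
  \<comment> \<open>\<open>C i\<close> will be the linear form induced by the product of the forms
    \<open>c (i r)\<close>.\<close>
  have "\<exists>g. lmap sW (*) g \<and> (\<forall>u. g (t u) = (\<Prod>r\<in>{1..k}. c (i r) (u r)))"
    if "i \<in> ?I" for i
  proof -
    have "multilinear sV k (*) (\<lambda>u. \<Prod>r\<in>{1..k}. c (i r) (u r))"
      using that by (intro multilinear_prod V.vector_space_axioms V.coord_linear)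
        (auto simp: multi_indices_def)
    with T show ?thesis unfolding tensor_power_def by blast
  qed
  then obtain C where C: "\<And>i. i \<in> ?I \<Longrightarrow> lmap sW (*) (C i)"
    and Ct: "\<And>i u. i \<in> ?I \<Longrightarrow> C i (t u) = (\<Prod>r\<in>{1..k}. c (i r) (u r))" by metis
  have dual: "C i (t (\<lambda>r. v (j r))) = (if i = j then 1 else 0)" if "i \<in> ?I" "j \<in> ?I" for i j
  proof -
    have "i r \<in> {1..n}" "j r \<in> {1..n}" if "r \<in> {1..k}" for r
      using that \<open>i \<in> ?I\<close> \<open>j \<in> ?I\<close> unfolding multi_indices_def by (blast intro: PiE_mem)+
    then have "C i (t (\<lambda>r. v (j r))) = (\<Prod>r\<in>{1..k}. if i r = j r then 1 else 0)"
      unfolding Ct[OF that(1)] by (intro prod.cong refl V.coord_basis)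
    moreover have "i = j" if "\<forall>r\<in>{1..k}. i r = j r"
      using that \<open>i \<in> ?I\<close> \<open>j \<in> ?I\<close> unfolding multi_indices_def by (intro PiE_ext) auto
    ultimately show ?thesis by (auto intro!: prod.neutral)
  qed
  \<comment> \<open>\<open>?P\<close> projects onto the span of the basis tensors. For every form
    \<open>h\<close>, the forms \<open>h\<close> and \<open>h\<close> after \<open>?P\<close> agree
    on basis tensors, hence on all pure tensors, and uniqueness makes them equal.\<close>
  have expand: "(\<Sum>i\<in>?I. sW (C i w) (t (\<lambda>r. v (i r)))) = w" for w
  proof (rule linear_forms_separate[OF W.vector_space_axioms])
    fix h assume h: "lmap sW (*) h"
    interpret h: Vector_Spaces.linear sW "(*)" h by (rule h)
    let ?P = "\<lambda>w. \<Sum>i\<in>?I. sW (C i w) (t (\<lambda>r. v (i r)))"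
    have "lmap sW sW ?P"
      using C by (auto simp: Vector_Spaces.linear_iff W.vector_space_axioms W.scale_left_distrib
          W.scale_sum_right sum.distrib intro!: sum.cong)
    then have hP: "lmap sW (*) (\<lambda>w. h (?P w))"
      using Vector_Spaces.linear_compose[of sW sW ?P "(*)" h] h by (simp add: o_def)
    have "(\<lambda>u. h (?P (t u))) = (\<lambda>u. h (t u))"
    proof (rule multilinear_eqI[OF V])
      show "multilinear sV k (*) (\<lambda>u. h (?P (t u)))" "multilinear sV k (*) (\<lambda>u. h (t u))"
        by (rule multilinear_compose[OF mult] hP h)+
      fix j assume j: "j \<in> ?I"
      have "?P (t (\<lambda>r. v (j r))) = (\<Sum>i\<in>?I. if i = j then t (\<lambda>r. v (j r)) else 0)"
        using j by (intro sum.cong) (auto simp: dual)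
      then show "h (?P (t (\<lambda>r. v (j r)))) = h (t (\<lambda>r. v (j r)))"
        using j fin by simp
    qed
    then have "\<forall>u. h (?P (t u)) = h (t u)" by (rule fun_cong[THEN allI])
    moreover have "\<exists>!g. lmap sW (*) g \<and> (\<forall>u. g (t u) = h (t u))"
      using T multilinear_compose[OF mult h] unfolding tensor_power_def by blast
    ultimately have "(\<lambda>w. h (?P w)) = h" using h hP by blast
    then show "h (?P w) = h w" by (rule fun_cong)
  qed
  have "dual_basis sW ?I (\<lambda>i. t (\<lambda>r. v (i r))) C"
    using fin C dual expand
    by (intro dual_basis.intro dual_basis_axioms.intro W.vector_space_axioms) auto
  then show ?thesis by (rule that)
qed

text \<open>This lifts the universal property from the scalar field to an arbitrary target:
  \<open>g\<close> is prescribed on basis tensors, and multilinearity carries the identity over to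
  all pure tensors.\<close>

lemma tensor_power_ex1:
  assumes V: "dual_basis sV {1..n} v c" and W: "dual_basis sW (multi_indices n k) (\<lambda>i. t (\<lambda>r. v (i r))) C"
    and T: "tensor_power sV k sW t" and X: "vector_space sX" and f: "multilinear sV k sX f"
  shows "\<exists>!g. lmap sW sX g \<and> (\<forall>u. g (t u) = f u)"
proof -
  interpret W: dual_basis sW "multi_indices n k" "\<lambda>i. t (\<lambda>r. v (i r))" C by fact
  obtain g where g: "lmap sW sX g" "\<And>i. i \<in> multi_indices n k \<Longrightarrow> g (t (\<lambda>r. v (i r))) = f (\<lambda>r. v (i r))"
    using W.ex1_linear[OF X, of "\<lambda>i. f (\<lambda>r. v (i r))"] by blast
  have "multilinear sV k sX (\<lambda>u. g (t u))"
    by (rule multilinear_compose[OF _ g(1)]) (use T in \<open>simp add: tensor_power_def\<close>)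
  from multilinear_eqI[OF V this f] g have "(\<lambda>u. g (t u)) = f" by blast
  then have "lmap sW sX g \<and> (\<forall>u. g (t u) = f u)" using g(1) by (metis (no_types))
  moreover have "g' = g" if "lmap sW sX g' \<and> (\<forall>u. g' (t u) = f u)" for g'
    using that by (intro W.linear_eqI[of sX]) (auto simp: g)
  ultimately show ?thesis by (rule ex1I)
qed


section \<open>Kernel partitions\<close>

text \<open>Indexing the fibres by points of \<open>A\<close> rather than by values keeps the empty
  set out.\<close>

definition kernel_partition :: "'a set \<Rightarrow> ('a \<Rightarrow> 'b) \<Rightarrow> 'a set set"
  where "kernel_partition A f = (\<lambda>p. {q \<in> A. f q = f p}) ` A"

lemma partition_on_kernel_partition: "partition_on A (kernel_partition A f)"
  unfolding kernel_partition_def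
proof (rule partition_onI)
  fix B C assume "B \<in> (\<lambda>p. {q \<in> A. f q = f p}) ` A" "C \<in> (\<lambda>p. {q \<in> A. f q = f p}) ` A" "B \<noteq> C"
  then obtain p q where "B = {r \<in> A. f r = f p}" "C = {r \<in> A. f r = f q}" by blast
  with \<open>B \<noteq> C\<close> show "disjnt B C" by (auto simp: disjnt_iff)
qed blast+

text \<open>The right-hand side is the condition in \<open>diagram_entry\<close>, so matrix entries
  become a matter of the refinement order.\<close>

lemma refines_kernel_partition_iff:
  assumes "partition_on A P"
  shows "refines A P (kernel_partition A f) \<longleftrightarrow> (\<forall>B\<in>P. \<forall>p\<in>B. \<forall>q\<in>B. f p = f q)"
proof
  assume ref: "refines A P (kernel_partition A f)"
  have "f p = f q" if "B \<in> P" "p \<in> B" "q \<in> B" for B p q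
  proof -
    from ref \<open>B \<in> P\<close> obtain r where "B \<subseteq> {q \<in> A. f q = f r}"
      unfolding refines_def kernel_partition_def by blast
    with that have "p \<in> {q \<in> A. f q = f r}" "q \<in> {q \<in> A. f q = f r}" by blast+
    then show ?thesis by simp
  qed
  then show "\<forall>B\<in>P. \<forall>p\<in>B. \<forall>q\<in>B. f p = f q" by blast
next
  assume const: "\<forall>B\<in>P. \<forall>p\<in>B. \<forall>q\<in>B. f p = f q"
  have "\<exists>Y\<in>kernel_partition A f. B \<subseteq> Y" if "B \<in> P" for B
  proof -
    have "B \<noteq> {}" using partition_onD3[OF assms] \<open>B \<in> P\<close> by blast
    then obtain p where "p \<in> B" by blast
    moreover have "B \<subseteq> A" using assms \<open>B \<in> P\<close> by (auto dest: partition_onD1)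
    ultimately have "B \<subseteq> {q \<in> A. f q = f p}" "p \<in> A" using const \<open>B \<in> P\<close> by blast+
    then show ?thesis unfolding kernel_partition_def by blast
  qed
  with assms show "refines A P (kernel_partition A f)"
    by (simp add: refines_def partition_on_kernel_partition)
qed

lemma kernel_partition_eq_iff:
  "kernel_partition A f = kernel_partition A g \<longleftrightarrow> (\<forall>p\<in>A. \<forall>q\<in>A. f p = f q \<longleftrightarrow> g p = g q)"
proof
  assume eq: "kernel_partition A f = kernel_partition A g"
  \<comment> \<open>\<open>f\<close> and \<open>g\<close> are generalised here because the
    implication is needed with their roles exchanged.\<close>
  have imp: "g p = g q" if "p \<in> A" "q \<in> A" "f p = f q" "kernel_partition A f = kernel_partition A g"
    for p q and f :: "'a \<Rightarrow> 'x" and g :: "'a \<Rightarrow> 'y"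
  proof -
    have "{r \<in> A. f r = f p} \<in> kernel_partition A f"
      unfolding kernel_partition_def using that(1) by (rule imageI)
    then have "{r \<in> A. f r = f p} \<in> kernel_partition A g" using that(4) by simp
    then obtain r where "{r \<in> A. f r = f p} = {q \<in> A. g q = g r}"
      unfolding kernel_partition_def by blast
    moreover have "p \<in> {r \<in> A. f r = f p}" "q \<in> {r \<in> A. f r = f p}" using that by auto
    ultimately show ?thesis by simp
  qed
  show "\<forall>p\<in>A. \<forall>q\<in>A. f p = f q \<longleftrightarrow> g p = g q"
    using imp[OF _ _ _ eq] imp[OF _ _ _ eq[symmetric]] by blast
next
  assume "\<forall>p\<in>A. \<forall>q\<in>A. f p = f q \<longleftrightarrow> g p = g q"
  then show "kernel_partition A f = kernel_partition A g"
    unfolding kernel_partition_def by (intro image_cong) auto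
qed

lemma card_kernel_partition: "card (kernel_partition A f) = card (f ` A)"
proof -
  have "kernel_partition A f = (\<lambda>y. {q \<in> A. f q = y}) ` f ` A"
    by (auto simp: kernel_partition_def)
  moreover have "inj_on (\<lambda>y. {q \<in> A. f q = y}) (f ` A)"
    by (rule inj_onI) auto
  ultimately show ?thesis by (simp add: card_image)
qed

text \<open>Each point receives the label that \<open>h\<close> gives to its block, and injectivity
  keeps the blocks apart. With labels in \<open>{1..n}\<close> this realises the diagrams with at
  most \<open>n\<close> blocks.\<close>

lemma partition_labelling:
  assumes P: "partition_on A P" and h: "inj_on h P"
  obtains f where "kernel_partition A f = P" and "\<And>B p. B \<in> P \<Longrightarrow> p \<in> B \<Longrightarrow> f p = h B"
proof
  define f where "f p = h (THE B. B \<in> P \<and> p \<in> B)" for p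
  show f: "f p = h B" if "B \<in> P" "p \<in> B" for B p
  proof -
    have "(THE B. B \<in> P \<and> p \<in> B) = B"
      using disjointD[OF partition_onD2[OF P]] that by (intro the_equality) blast+
    then show ?thesis by (simp add: f_def)
  qed
  have block: "{q \<in> A. f q = f p} = B" if B: "B \<in> P" "p \<in> B" for p B
  proof (rule Set.set_eqI)
    fix q
    have "q \<in> B" if "q \<in> A" "f q = f p"
    proof -
      obtain C where "C \<in> P" "q \<in> C" using P \<open>q \<in> A\<close> by (auto dest: partition_onD1)
      with B f that h show ?thesis by (metis inj_onD)
    qed
    moreover have "q \<in> A" "f q = f p" if "q \<in> B"
      using that B f P by (auto dest: partition_onD1)
    ultimately show "q \<in> {q \<in> A. f q = f p} \<longleftrightarrow> q \<in> B" by blast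
  qed
  show "kernel_partition A f = P"
  proof (intro equalityI subsetI)
    fix B assume "B \<in> P"
    then have "B \<noteq> {}" using partition_onD3[OF P] by blast
    then obtain p where p: "p \<in> B" by blast
    with \<open>B \<in> P\<close> P have "p \<in> A" by (auto dest: partition_onD1)
    with block[OF \<open>B \<in> P\<close> p] show "B \<in> kernel_partition A f"
      unfolding kernel_partition_def by blast
  next
    fix B assume "B \<in> kernel_partition A f"
    then obtain p where p: "p \<in> A" "B = {q \<in> A. f q = f p}" by (auto simp: kernel_partition_def)
    then obtain C where "C \<in> P" "p \<in> C" using P by (auto dest: partition_onD1)
    with block p show "B \<in> P" by simp
  qed
qed

text \<open>Equality of the kernels says that sending \<open>f p\<close> to \<open>g p\<close> is a
  well-defined bijection between the two images. Their complements in \<open>S\<close> then have the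
  same size, and a bijection between these completes the permutation.\<close>

lemma permutation_between_labellings:
  assumes S: "finite S" and f: "f ` A \<subseteq> S" and g: "g ` A \<subseteq> S"
    and ker: "kernel_partition A f = kernel_partition A g"
  obtains \<sigma> where "\<sigma> permutes S" and "\<And>p. p \<in> A \<Longrightarrow> g p = \<sigma> (f p)"
proof -
  have same: "f p = f q \<longleftrightarrow> g p = g q" if "p \<in> A" "q \<in> A" for p q
    using ker that unfolding kernel_partition_eq_iff by blast
  \<comment> \<open>\<open>inv_into\<close> picks some preimage; by \<open>same\<close> the value
    does not depend on the choice.\<close>
  define \<tau> where "\<tau> y = g (inv_into A f y)" for y
  have \<tau>f: "\<tau> (f p) = g p" if "p \<in> A" for p
    using that same[of "inv_into A f (f p)" p] unfolding \<tau>_def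
    by (simp add: inv_into_into f_inv_into_f)
  have \<tau>: "bij_betw \<tau> (f ` A) (g ` A)"
  proof (rule bij_betw_imageI)
    show "inj_on \<tau> (f ` A)" by (rule inj_onI) (auto simp: \<tau>f same)
    show "\<tau> ` f ` A = g ` A" using \<tau>f by (auto simp: image_image)
  qed
  have "card (S - f ` A) = card (S - g ` A)"
    using f g S bij_betw_same_card[OF \<tau>] by (simp add: card_Diff_subset finite_subset)
  then obtain \<rho> where \<rho>: "bij_betw \<rho> (S - f ` A) (S - g ` A)"
    using S by (meson finite_Diff finite_same_card_bij)
  \<comment> \<open>The last branch fixes the points outside \<open>S\<close>, as
    \<open>permutes\<close> demands.\<close>
  let ?\<sigma> = "\<lambda>y. if y \<in> f ` A then \<tau> y else if y \<in> S - f ` A then \<rho> y else y"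
  have "bij_betw ?\<sigma> (f ` A \<union> (S - f ` A)) (g ` A \<union> (S - g ` A))"
  proof (rule bij_betw_combine)
    show "bij_betw ?\<sigma> (f ` A) (g ` A)" using \<tau> by (rule bij_betw_cong[THEN iffD1, rotated]) simp
    show "bij_betw ?\<sigma> (S - f ` A) (S - g ` A)"
      using \<rho> by (rule bij_betw_cong[THEN iffD1, rotated]) simp
  qed auto
  moreover have "f ` A \<union> (S - f ` A) = S" "g ` A \<union> (S - g ` A) = S" using f g by auto
  ultimately have "?\<sigma> permutes S" using f by (intro bij_imp_permutes) auto
  moreover have "g p = ?\<sigma> (f p)" if "p \<in> A" for p using that by (simp add: \<tau>f)
  ultimately show ?thesis by (rule that)
qed


section \<open>Coordinates with respect to the elements \<open>x\<^sub>d\<close>\<close>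

interpretation diagram_space: vector_space diagram_scale
  by unfold_locales (auto simp: diagram_scale_def fun_eq_iff algebra_simps)

lemma sum_fun_apply: "(\<Sum>a\<in>A. f a) q = (\<Sum>a\<in>A. f a q)"
  by (induction A rule: infinite_finite_induct) auto

text \<open>The zeta transform of the refinement order. Since \<open>single d\<close> is the sum of
  the orbit elements of the diagrams in \<open>D\<close> equal to or coarser than \<open>d\<close>,
  this is, for \<open>a\<close> supported on \<open>D\<close> and \<open>e\<close> in
  \<open>D\<close>, the coefficient of the orbit element of \<open>e\<close> in
  \<open>a\<close>.\<close>

definition lower_sum :: "nat \<Rightarrow> diagram set \<Rightarrow> (diagram \<Rightarrow> complex) \<Rightarrow> diagram \<Rightarrow> complex"
  where "lower_sum k D a e = (\<Sum>d | d \<in> D \<and> refines (vertices k) d e. a d)"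

context
  fixes k :: nat and D :: "diagram set"
  assumes D: "D \<subseteq> diagrams k"
begin

lemma finite_D: "finite D"
  using D finite_diagrams by (rule finite_subset)

text \<open>A nonzero family with vanishing upper sums could be added to the family of the
  \<open>x\<^sub>d\<close> without violating the relations that determine it.\<close>

lemma upper_sums_zeroD:
  fixes y :: "diagram \<Rightarrow> complex"
  assumes y: "\<And>d. d \<in> D \<Longrightarrow> (\<Sum>d' | d' \<in> D \<and> refines (vertices k) d d'. y d') = 0"
    and d: "d \<in> D"
  shows "y d = 0"
proof -
  \<comment> \<open>The scalar \<open>y d\<close> is added as a constant function, a vector of the
    function space in which the orbit elements live.\<close>
  define z where "z = (\<lambda>d. if d \<in> D then orbit_element k D d + (\<lambda>_. y d) else 0)"
  have "is_orbit_family k D z"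
    unfolding is_orbit_family_def
  proof (intro conjI ballI allI impI)
    fix d assume d: "d \<in> D"
    have "(\<Sum>d' | d' \<in> D \<and> refines (vertices k) d d'. z d') =
        (\<Sum>d' | d' \<in> D \<and> refines (vertices k) d d'. orbit_element k D d') +
        (\<Sum>d' | d' \<in> D \<and> refines (vertices k) d d'. (\<lambda>_. y d'))"
      unfolding sum.distrib[symmetric] by (intro sum.cong) (auto simp: z_def)
    moreover have "(\<Sum>d' | d' \<in> D \<and> refines (vertices k) d d'. (\<lambda>_::diagram. y d')) = 0"
      using y[OF d] by (simp add: fun_eq_iff sum_fun_apply)
    ultimately show "single d = (\<Sum>d' | d' \<in> D \<and> refines (vertices k) d d'. z d')"
      using orbit_element_sum[OF D d] by simp
  qed (simp add: z_def)
  then have "z d = orbit_element k D d" using orbit_element_unique[OF D] by simp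
  then show ?thesis using d by (simp add: z_def fun_eq_iff)
qed

lemma single_eq_sum:
  assumes "d \<in> D"
  shows "single d q = (\<Sum>d' | d' \<in> D \<and> refines (vertices k) d d'. orbit_element k D d' q)"
  by (subst orbit_element_sum[OF D assms]) (simp add: sum_fun_apply)

text \<open>For fixed \<open>q\<close>, the upper sums of the values at \<open>q\<close> are the
  numbers \<open>single d q\<close>, which vanish because \<open>d\<close> lies in \<open>D\<close>
  and \<open>q\<close> does not.\<close>

lemma orbit_element_support: "d \<in> D \<Longrightarrow> q \<notin> D \<Longrightarrow> orbit_element k D d q = 0"
  by (rule upper_sums_zeroD) (auto simp: single_eq_sum[symmetric] single_def)

lemma lower_sum_single:
  assumes "d \<in> D"
  shows "lower_sum k D (single d) e = (if refines (vertices k) d e then 1 else 0)"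
  using assms finite_D by (simp add: lower_sum_def single_def)

lemma lower_sum_linear: "lmap diagram_scale (*) (\<lambda>a. lower_sum k D a e)"
  by (simp add: Vector_Spaces.linear_iff diagram_space.vector_space_axioms vector_space_times
      lower_sum_def sum.distrib diagram_scale_def sum_distrib_left)

text \<open>As functions of \<open>d\<close>, both sides have the same upper sums: by linearity
  those on the left give the lower sum of \<open>single d\<close>, which is the indicator of
  \<open>d\<close> refining \<open>e\<close>. Then \<open>upper_sums_zeroD\<close> applies to the
  difference.\<close>

lemma lower_sum_orbit_element:
  assumes d: "d \<in> D" and e: "e \<in> D"
  shows "lower_sum k D (orbit_element k D d) e = (if d = e then 1 else 0)"
proof -
  have "lower_sum k D (orbit_element k D d) e - (if d = e then 1 else 0) = 0"
  proof (rule upper_sums_zeroD[OF _ d])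
    fix d assume d: "d \<in> D"
    interpret L: Vector_Spaces.linear diagram_scale "(*)" "\<lambda>a. lower_sum k D a e"
      by (rule lower_sum_linear)
    have "(\<Sum>d' | d' \<in> D \<and> refines (vertices k) d d'. lower_sum k D (orbit_element k D d') e) =
        lower_sum k D (single d) e"
      unfolding orbit_element_sum[OF D d] by (rule L.sum[symmetric])
    also have "\<dots> = (\<Sum>d' | d' \<in> D \<and> refines (vertices k) d d'. if d' = e then 1 else 0)"
      using e finite_D by (simp add: lower_sum_single[OF d])
    finally show "(\<Sum>d' | d' \<in> D \<and> refines (vertices k) d d'.
        lower_sum k D (orbit_element k D d') e - (if d' = e then 1 else 0)) = 0"
      by (simp add: sum_subtractf)
  qed
  then show ?thesis by simp
qed

text \<open>Expanding every \<open>single d\<close> in orbit elements and exchanging the sums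
  collects at each \<open>d'\<close> the coefficients of the diagrams refining it.\<close>

lemma orbit_expansion:
  assumes a: "\<And>d. d \<notin> D \<Longrightarrow> a d = 0"
  shows "a = (\<Sum>d\<in>D. diagram_scale (lower_sum k D a d) (orbit_element k D d))"
proof
  fix q
  have "a q = (\<Sum>d\<in>D. a d * single d q)"
    using a finite_D by (simp add: single_def if_distrib cong: if_cong)
  also have "\<dots> = (\<Sum>d\<in>D. \<Sum>d' | d' \<in> D \<and> refines (vertices k) d d'. a d * orbit_element k D d' q)"
    by (intro sum.cong) (simp_all add: single_eq_sum sum_distrib_left)
  also have "\<dots> = (\<Sum>d'\<in>D. \<Sum>d | d \<in> D \<and> refines (vertices k) d d'. a d * orbit_element k D d' q)"
    by (rule sum.swap_restrict) (rule finite_D)+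
  also have "\<dots> = (\<Sum>d\<in>D. diagram_scale (lower_sum k D a d) (orbit_element k D d)) q"
    by (simp add: lower_sum_def sum_distrib_right diagram_scale_def sum_fun_apply)
  finally show "a q = (\<Sum>d\<in>D. diagram_scale (lower_sum k D a d) (orbit_element k D d)) q" .
qed

text \<open>The combination of orbit elements with coefficients \<open>b\<close> works. It will
  supply preimages under the representation.\<close>

lemma lower_sum_surj:
  obtains a where "\<And>d. d \<notin> D \<Longrightarrow> a d = 0" and "\<And>d. d \<in> D \<Longrightarrow> lower_sum k D a d = b d"
proof
  let ?a = "\<Sum>d\<in>D. diagram_scale (b d) (orbit_element k D d)"
  show "?a d = 0" if "d \<notin> D" for d
    using that by (simp add: sum_fun_apply diagram_scale_def orbit_element_support)
  show "lower_sum k D ?a e = b e" if e: "e \<in> D" for e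
  proof -
    interpret L: Vector_Spaces.linear diagram_scale "(*)" "\<lambda>a. lower_sum k D a e"
      by (rule lower_sum_linear)
    have "lower_sum k D ?a e = (\<Sum>d\<in>D. if d = e then b e else 0)"
      unfolding L.sum using e by (intro sum.cong) (auto simp: L.scale lower_sum_orbit_element)
    then show ?thesis using e finite_D by simp
  qed
qed

text \<open>The orbit elements form a basis with coordinates \<open>lower_sum\<close>, so the span
  of some of them is cut out by the vanishing of the other coordinates.\<close>

lemma span_orbit_elements:
  "lspan diagram_scale (orbit_element k D ` {d \<in> D. P d}) =
    {a. (\<forall>d. d \<notin> D \<longrightarrow> a d = 0) \<and> (\<forall>d\<in>D. \<not> P d \<longrightarrow> lower_sum k D a d = 0)}"
  (is "_ = ?S")
proof
  have "diagram_space.subspace ?S"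
    using lower_sum_linear
    by (intro diagram_space.subspaceI) (auto simp: Vector_Spaces.linear_iff lower_sum_def
        diagram_scale_def sum.distrib sum_distrib_left[symmetric])
  moreover have "orbit_element k D ` {d \<in> D. P d} \<subseteq> ?S"
    by (auto simp: orbit_element_support lower_sum_orbit_element)
  ultimately show "lspan diagram_scale (orbit_element k D ` {d \<in> D. P d}) \<subseteq> ?S"
    by (intro diagram_space.span_minimal)
  show "?S \<subseteq> lspan diagram_scale (orbit_element k D ` {d \<in> D. P d})"
  proof
    fix a assume a: "a \<in> ?S"
    have "diagram_scale (lower_sum k D a d) (orbit_element k D d)
        \<in> lspan diagram_scale (orbit_element k D ` {d \<in> D. P d})"
      if "d \<in> D" for d
      using a that
      by (cases "P d") (auto intro: diagram_space.span_scale diagram_space.span_base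
          diagram_space.span_zero)
    then have "(\<Sum>d\<in>D. diagram_scale (lower_sum k D a d) (orbit_element k D d))
        \<in> lspan diagram_scale (orbit_element k D ` {d \<in> D. P d})"
      by (rule diagram_space.span_sum)
    then show "a \<in> lspan diagram_scale (orbit_element k D ` {d \<in> D. P d})"
      using a by (subst orbit_expansion) auto
  qed
qed

end


section \<open>Representations given by kernel partitions\<close>

text \<open>Linear combinations of diagrams act by matrices that depend on \<open>(i, j)\<close> only through the
  partition \<open>\<kappa> i j\<close>, and the entry at \<open>(i, j)\<close> is the coefficient of \<open>x\<^sub>d\<close> for \<open>d = \<kappa> i j\<close>.\<close>

lemma
  fixes sW :: "complex \<Rightarrow> 'w \<Rightarrow> 'w::ab_group_add" and e :: "'i \<Rightarrow> 'w"
  assumes W: "dual_basis sW I e C" and D: "D \<subseteq> diagrams K"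
    and F: "\<And>a. F a = (\<lambda>w. \<Sum>d\<in>D. sW (a d) (dual_basis.operator sW I e
      (\<lambda>i j. if refines (vertices K) d (\<kappa> i j) then 1 else 0) w))"
    and range: "{\<kappa> i j | i j. i \<in> I \<and> j \<in> I} = {d \<in> D. \<not> n < card d}"
    and act: "\<And>\<sigma>. \<sigma> \<in> G \<Longrightarrow> lmap sW sW (act \<sigma>)"
    and act_basis: "\<And>\<sigma> i. \<sigma> \<in> G \<Longrightarrow> i \<in> I \<Longrightarrow> act \<sigma> (e i) = e (p \<sigma> i)"
    and p: "\<And>\<sigma>. \<sigma> \<in> G \<Longrightarrow> bij_betw (p \<sigma>) I I"
    and orbits: "\<And>i j i' j'. i \<in> I \<Longrightarrow> j \<in> I \<Longrightarrow> i' \<in> I \<Longrightarrow> j' \<in> I \<Longrightarrow>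
      \<kappa> i j = \<kappa> i' j' \<longleftrightarrow> (\<exists>\<sigma>\<in>G. i' = p \<sigma> i \<and> j' = p \<sigma> j)"
  shows diagram_action_image: "F ` carrier (diagram_algebra k D n) =
      {f. lmap sW sW f \<and> (\<forall>\<sigma>\<in>G. f \<circ> act \<sigma> = act \<sigma> \<circ> f)}"
    and diagram_action_kernel: "kernel_on F (diagram_algebra k D n) =
      lspan (smult (diagram_algebra k D n)) (orbit_element K D ` {d \<in> D. n < card d})"
proof -
  interpret W: dual_basis sW I e C by fact
  have finD: "finite D" using D finite_diagrams by (rule finite_subset)
  have F_op: "F a = W.operator (\<lambda>i j. lower_sum K D a (\<kappa> i j))" for a
    unfolding F W.sum_operator W.operator_eq_iff
    using finD by (simp add: lower_sum_def sum.inter_filter if_distrib cong: if_cong)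
  have carrier: "carrier (diagram_algebra k D n) = {a. \<forall>d. d \<notin> D \<longrightarrow> a d = 0}"
    by (simp add: diagram_algebra_def)
  have \<kappa>_p: "\<kappa> (p \<sigma> i) (p \<sigma> j) = \<kappa> i j" if "\<sigma> \<in> G" "i \<in> I" "j \<in> I" for \<sigma> i j
  proof -
    have "p \<sigma> i \<in> I" "p \<sigma> j \<in> I" using p[OF that(1)] that by (auto dest: bij_betw_apply)
    with orbits[OF that(2,3), of "p \<sigma> i" "p \<sigma> j"] that show ?thesis by auto
  qed
  have commute: "W.operator M \<circ> act \<sigma> = act \<sigma> \<circ> W.operator M \<longleftrightarrow>
      (\<forall>i\<in>I. \<forall>j\<in>I. M (p \<sigma> i) (p \<sigma> j) = M i j)" if "\<sigma> \<in> G" for \<sigma> M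
    using that by (intro W.operator_commute_iff act act_basis p)
  show "F ` carrier (diagram_algebra k D n) =
      {f. lmap sW sW f \<and> (\<forall>\<sigma>\<in>G. f \<circ> act \<sigma> = act \<sigma> \<circ> f)}"
  proof (intro equalityI subsetI)
    fix f assume "f \<in> F ` carrier (diagram_algebra k D n)"
    then obtain a where f: "f = W.operator (\<lambda>i j. lower_sum K D a (\<kappa> i j))"
      unfolding F_op by blast
    have "f \<circ> act \<sigma> = act \<sigma> \<circ> f" if "\<sigma> \<in> G" for \<sigma>
      unfolding f commute[OF that] using that by (simp add: \<kappa>_p)
    then show "f \<in> {f. lmap sW sW f \<and> (\<forall>\<sigma>\<in>G. f \<circ> act \<sigma> = act \<sigma> \<circ> f)}"
      by (simp add: f W.operator_linear)
  next
    fix f assume "f \<in> {f. lmap sW sW f \<and> (\<forall>\<sigma>\<in>G. f \<circ> act \<sigma> = act \<sigma> \<circ> f)}"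
    then have f: "lmap sW sW f" and comm: "\<And>\<sigma>. \<sigma> \<in> G \<Longrightarrow> f \<circ> act \<sigma> = act \<sigma> \<circ> f" by auto
    define M where "M i j = C j (f (e i))" for i j
    have f_M: "f = W.operator M" unfolding M_def by (rule W.linear_is_operator[OF f])
    have M_p: "M (p \<sigma> i) (p \<sigma> j) = M i j" if "\<sigma> \<in> G" "i \<in> I" "j \<in> I" for \<sigma> i j
      using comm[OF that(1)] that(2,3) unfolding f_M commute[OF that(1)] by blast
    \<comment> \<open>\<open>q d\<close> selects a pair of indices with partition \<open>d\<close>,
      and \<open>b d\<close> is the entry of \<open>M\<close> there. By \<open>orbits\<close> and
      the invariance of \<open>M\<close> every such pair has the same entry, so \<open>M\<close>
      factors through \<open>\<kappa>\<close>. Where no pair exists the value is arbitrary.\<close>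
    define q where "q d = (SOME q. fst q \<in> I \<and> snd q \<in> I \<and> \<kappa> (fst q) (snd q) = d)" for d
    define b where "b d = M (fst (q d)) (snd (q d))" for d
    have b: "b (\<kappa> i j) = M i j" if ij: "i \<in> I" "j \<in> I" for i j
    proof -
      have q: "fst (q (\<kappa> i j)) \<in> I \<and> snd (q (\<kappa> i j)) \<in> I \<and>
          \<kappa> (fst (q (\<kappa> i j))) (snd (q (\<kappa> i j))) = \<kappa> i j"
        unfolding q_def by (rule someI[of _ "(i, j)"]) (simp add: ij)
      then obtain \<sigma> where "\<sigma> \<in> G" "fst (q (\<kappa> i j)) = p \<sigma> i" "snd (q (\<kappa> i j)) = p \<sigma> j"
        using orbits[OF ij, of "fst (q (\<kappa> i j))" "snd (q (\<kappa> i j))"] by auto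
      then show ?thesis using M_p[OF _ ij] by (simp add: b_def)
    qed
    obtain a where a: "\<And>d. d \<notin> D \<Longrightarrow> a d = 0" "\<And>d. d \<in> D \<Longrightarrow> lower_sum K D a d = b d"
      by (rule lower_sum_surj[OF D, of b]) blast
    have "\<kappa> i j \<in> D" if "i \<in> I" "j \<in> I" for i j using range that by blast
    then have "f = F a" unfolding f_M F_op W.operator_eq_iff using a(2) b by simp
    with a(1) show "f \<in> F ` carrier (diagram_algebra k D n)" by (auto simp: carrier)
  qed
  \<comment> \<open>The entries are the coordinates at the partitions \<open>\<kappa> i j\<close>.
    By \<open>range\<close> these are the members of \<open>D\<close> with at most \<open>n\<close>
    blocks, so only the coordinates at diagrams with more blocks stay free.\<close>
  have "F a = (\<lambda>_. 0) \<longleftrightarrow> (\<forall>d\<in>{\<kappa> i j | i j. i \<in> I \<and> j \<in> I}. lower_sum K D a d = 0)" for a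
    unfolding F_op W.operator_eq_0_iff by blast
  then have "F a = (\<lambda>_. 0) \<longleftrightarrow> (\<forall>d\<in>D. \<not> n < card d \<longrightarrow> lower_sum K D a d = 0)" for a
    unfolding range by blast
  moreover have "smult (diagram_algebra k D n) = diagram_scale"
    by (simp add: diagram_algebra_def)
  ultimately show "kernel_on F (diagram_algebra k D n) =
      lspan (smult (diagram_algebra k D n)) (orbit_element K D ` {d \<in> D. n < card d})"
    by (simp add: span_orbit_elements[OF D] kernel_on_def carrier)
qed


section \<open>Multi-indices and diagrams\<close>

text \<open>\<open>i\<close> and \<open>j\<close> need not be extensional, so composites with a
  permutation are allowed.\<close>

definition index_partition :: "nat \<Rightarrow> (nat \<Rightarrow> nat) \<Rightarrow> (nat \<Rightarrow> nat) \<Rightarrow> diagram"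
  where "index_partition k i j = kernel_partition (vertices k) (vertex_label i j)"

text \<open>The restriction makes the result extensional, hence again a multi-index.\<close>

definition index_act :: "nat \<Rightarrow> (nat \<Rightarrow> nat) \<Rightarrow> (nat \<Rightarrow> nat) \<Rightarrow> nat \<Rightarrow> nat"
  where "index_act k \<sigma> i = (\<lambda>r\<in>{1..k}. \<sigma> (i r))"

lemma ball_vertices: "(\<forall>q\<in>vertices k. P q) \<longleftrightarrow> (\<forall>r\<in>{1..k}. P (Top r) \<and> P (Bot r))"
  by (auto simp: vertices_def)

lemma ball_atLeastAtMost_Suc: "(\<forall>r\<in>{1..Suc k}. P r) \<longleftrightarrow> (\<forall>r\<in>{1..k}. P r) \<and> P (Suc k)"
proof -
  have "{1..Suc k} = insert (Suc k) {1..k}" by auto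
  then show ?thesis by (simp only: ball_simps conj_commute)
qed

lemma multi_indices_iff: "i \<in> multi_indices n k \<longleftrightarrow> i \<in> extensional {1..k} \<and> (\<forall>r\<in>{1..k}. i r \<in> {1..n})"
  unfolding multi_indices_def PiE_iff by blast

lemma diagram_entry_refines:
  assumes "d \<in> diagrams k"
  shows "diagram_entry d = (\<lambda>i j. if refines (vertices k) d (index_partition k i j) then 1 else 0)"
  using assms unfolding diagrams_def diagram_entry_def[abs_def] index_partition_def
  by (simp add: refines_kernel_partition_iff)

lemma index_partition_mem: "index_partition k i j \<in> diagrams k"
  by (simp add: index_partition_def diagrams_def partition_on_kernel_partition)

lemma card_index_partition_le:
  assumes "\<And>r. r \<in> {1..k} \<Longrightarrow> i r \<in> {1..n} \<and> j r \<in> {1..n}"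
  shows "card (index_partition k i j) \<le> n"
proof -
  have "\<forall>q\<in>vertices k. vertex_label i j q \<in> {1..n}"
    unfolding ball_vertices using assms by simp
  then have "card (vertex_label i j ` vertices k) \<le> card {1..n}"
    by (intro card_mono) auto
  then show ?thesis by (simp add: index_partition_def card_kernel_partition)
qed

text \<open>At most \<open>n\<close> blocks can be numbered injectively by \<open>{1..n}\<close>;
  the numbers of the blocks containing \<open>Top r\<close> and \<open>Bot r\<close> serve as
  \<open>i r\<close> and \<open>j r\<close>.\<close>

lemma diagram_labelling:
  assumes d: "d \<in> diagrams k" and card: "card d \<le> n"
  obtains i j where "index_partition k i j = d"
    and "\<And>r. r \<in> {1..k} \<Longrightarrow> i r \<in> {1..n} \<and> j r \<in> {1..n}"
proof -
  have P: "partition_on (vertices k) d" using d by (simp add: diagrams_def)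
  have "finite (vertices k)" by (simp add: vertices_def)
  with P have "finite d" by (rule finite_elements[rotated])
  with card obtain h where h: "h ` d \<subseteq> {1..n}" "inj_on h d"
    using card_le_inj[of d "{1..n}"] by auto
  obtain f where f: "kernel_partition (vertices k) f = d" "\<And>B q. B \<in> d \<Longrightarrow> q \<in> B \<Longrightarrow> f q = h B"
    using partition_labelling[OF P h(2)] by blast
  have range: "f q \<in> {1..n}" if "q \<in> vertices k" for q
  proof -
    have "q \<in> \<Union>d" using that partition_onD1[OF P] by simp
    then obtain B where "B \<in> d" "q \<in> B" by blast
    with f(2) h(1) show ?thesis by auto
  qed
  have "vertex_label (\<lambda>r. f (Top r)) (\<lambda>r. f (Bot r)) = f"
  proof
    show "vertex_label (\<lambda>r. f (Top r)) (\<lambda>r. f (Bot r)) q = f q" for q by (cases q) auto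
  qed
  then have "index_partition k (\<lambda>r. f (Top r)) (\<lambda>r. f (Bot r)) = d"
    using f(1) by (simp add: index_partition_def)
  moreover have "Top r \<in> vertices k" "Bot r \<in> vertices k" if "r \<in> {1..k}" for r
    using that by (auto simp: vertices_def)
  ultimately show ?thesis using range by (intro that) blast+
qed

section \<open>Equality of index partitions\<close>

lemma index_partition_eq_iff_labels:
  "index_partition k i j = index_partition k i' j' \<longleftrightarrow>
    (\<forall>q\<in>vertices k. \<forall>q'\<in>vertices k. vertex_label i j q = vertex_label i j q' \<longleftrightarrow>
      vertex_label i' j' q = vertex_label i' j' q')"
  by (simp add: index_partition_def kernel_partition_eq_iff)

lemma index_partition_cong:
  assumes "\<And>r. r \<in> {1..k} \<Longrightarrow> i r = i' r \<and> j r = j' r"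
  shows "index_partition k i j = index_partition k i' j'"
proof -
  have "\<forall>q\<in>vertices k. vertex_label i j q = vertex_label i' j' q"
    unfolding ball_vertices using assms by simp
  then show ?thesis by (simp add: index_partition_eq_iff_labels)
qed

lemma index_partition_compose:
  assumes "inj \<sigma>"
  shows "index_partition k (\<lambda>r. \<sigma> (i r)) (\<lambda>r. \<sigma> (j r)) = index_partition k i j"
proof -
  have "vertex_label (\<lambda>r. \<sigma> (i r)) (\<lambda>r. \<sigma> (j r)) q = \<sigma> (vertex_label i j q)" for q by (cases q) auto
  with assms show ?thesis by (simp add: index_partition_eq_iff_labels inj_eq)
qed

text \<open>The permutation comes from \<open>permutation_between_labellings\<close>, applied to the
  labels of all vertices. Conversely, an injective relabelling changes no block.\<close>

lemma index_partition_eq_iff: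
  assumes ij: "\<And>r. r \<in> {1..k} \<Longrightarrow> i r \<in> {1..n} \<and> j r \<in> {1..n}"
    and ij': "\<And>r. r \<in> {1..k} \<Longrightarrow> i' r \<in> {1..n} \<and> j' r \<in> {1..n}"
  shows "index_partition k i j = index_partition k i' j' \<longleftrightarrow>
    (\<exists>\<sigma>\<in>symm_group n. \<forall>r\<in>{1..k}. i' r = \<sigma> (i r) \<and> j' r = \<sigma> (j r))"
proof
  assume "index_partition k i j = index_partition k i' j'"
  moreover have "\<forall>q\<in>vertices k. vertex_label i j q \<in> {1..n}"
    "\<forall>q\<in>vertices k. vertex_label i' j' q \<in> {1..n}"
    unfolding ball_vertices using ij ij' by simp_all
  ultimately obtain \<sigma> where \<sigma>: "\<sigma> permutes {1..n}"
    "\<And>q. q \<in> vertices k \<Longrightarrow> vertex_label i' j' q = \<sigma> (vertex_label i j q)"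
    unfolding index_partition_def
    using permutation_between_labellings[of "{1..n}" "vertex_label i j" "vertices k" "vertex_label i' j'"]
    by blast
  then have "\<forall>q\<in>vertices k. vertex_label i' j' q = \<sigma> (vertex_label i j q)" by blast
  then show "\<exists>\<sigma>\<in>symm_group n. \<forall>r\<in>{1..k}. i' r = \<sigma> (i r) \<and> j' r = \<sigma> (j r)"
    unfolding ball_vertices symm_group_def using \<sigma>(1) by auto
next
  assume "\<exists>\<sigma>\<in>symm_group n. \<forall>r\<in>{1..k}. i' r = \<sigma> (i r) \<and> j' r = \<sigma> (j r)"
  then obtain \<sigma> where \<sigma>: "\<sigma> permutes {1..n}" "\<And>r. r \<in> {1..k} \<Longrightarrow> i' r = \<sigma> (i r) \<and> j' r = \<sigma> (j r)"
    unfolding symm_group_def by blast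
  have "index_partition k i' j' = index_partition k (\<lambda>r. \<sigma> (i r)) (\<lambda>r. \<sigma> (j r))"
    using \<sigma>(2) by (rule index_partition_cong)
  then show "index_partition k i j = index_partition k i' j'"
    using permutes_inj[OF \<sigma>(1)] by (simp add: index_partition_compose)
qed

section \<open>Permutations acting on multi-indices\<close>

lemma index_act_mem:
  assumes "\<sigma> \<in> symm_group n" and "i \<in> multi_indices n k"
  shows "index_act k \<sigma> i \<in> multi_indices n k"
proof -
  have "\<sigma> (i r) \<in> {1..n}" if "r \<in> {1..k}" for r
    using assms that unfolding symm_group_def multi_indices_iff by (metis mem_Collect_eq permutes_in_image)
  then show ?thesis by (auto simp: multi_indices_iff index_act_def)
qed

lemma index_act_bij:
  assumes "\<sigma> \<in> symm_group n"
  shows "bij_betw (index_act k \<sigma>) (multi_indices n k) (multi_indices n k)"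
proof (rule bij_betwI)
  have \<sigma>: "\<sigma> permutes {1..n}" using assms by (simp add: symm_group_def)
  then have inv: "inv_into UNIV \<sigma> \<in> symm_group n" by (simp add: symm_group_def permutes_inv)
  show "index_act k \<sigma> \<in> multi_indices n k \<rightarrow> multi_indices n k"
    "index_act k (inv_into UNIV \<sigma>) \<in> multi_indices n k \<rightarrow> multi_indices n k"
    using index_act_mem[OF assms] index_act_mem[OF inv] by blast+
  show "index_act k (inv_into UNIV \<sigma>) (index_act k \<sigma> i) = i" "index_act k \<sigma> (index_act k (inv_into UNIV \<sigma>) i) = i"
    if "i \<in> multi_indices n k" for i
    using that permutes_inverses[OF \<sigma>]
    by (auto simp: index_act_def multi_indices_iff extensional_def fun_eq_iff)
qed

lemma eq_index_act_iff:
  assumes "i' \<in> multi_indices n k"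
  shows "i' = index_act k \<sigma> i \<longleftrightarrow> (\<forall>r\<in>{1..k}. i' r = \<sigma> (i r))"
proof
  assume eq: "\<forall>r\<in>{1..k}. i' r = \<sigma> (i r)"
  show "i' = index_act k \<sigma> i"
  proof (rule extensionalityI[of _ "{1..k}"])
    show "i' \<in> extensional {1..k}" using assms by (simp add: multi_indices_iff)
  qed (use eq in \<open>auto simp: index_act_def\<close>)
qed (simp add: index_act_def)

lemma index_partition_orbits:
  assumes "i \<in> multi_indices n k" "j \<in> multi_indices n k" "i' \<in> multi_indices n k" "j' \<in> multi_indices n k"
  shows "index_partition k i j = index_partition k i' j' \<longleftrightarrow>
    (\<exists>\<sigma>\<in>symm_group n. i' = index_act k \<sigma> i \<and> j' = index_act k \<sigma> j)"
proof -
  have "index_partition k i j = index_partition k i' j' \<longleftrightarrow>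
      (\<exists>\<sigma>\<in>symm_group n. \<forall>r\<in>{1..k}. i' r = \<sigma> (i r) \<and> j' r = \<sigma> (j r))"
    using assms by (intro index_partition_eq_iff) (auto simp: multi_indices_iff)
  then show ?thesis
    by (simp only: eq_index_act_iff[OF assms(3)] eq_index_act_iff[OF assms(4)] ball_conj_distrib)
qed

lemma index_partition_range:
  "{index_partition k i j | i j. i \<in> multi_indices n k \<and> j \<in> multi_indices n k} =
    {d \<in> diagrams k. \<not> n < card d}"
proof (intro equalityI subsetI)
  fix d assume "d \<in> {index_partition k i j | i j. i \<in> multi_indices n k \<and> j \<in> multi_indices n k}"
  then show "d \<in> {d \<in> diagrams k. \<not> n < card d}"
    using card_index_partition_le[of k _ n] by (auto simp: index_partition_mem multi_indices_iff not_less)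
next
  fix d assume "d \<in> {d \<in> diagrams k. \<not> n < card d}"
  then have "d \<in> diagrams k" "card d \<le> n" by auto
  then obtain i j where ij: "index_partition k i j = d"
    "\<And>r. r \<in> {1..k} \<Longrightarrow> i r \<in> {1..n} \<and> j r \<in> {1..n}" by (rule diagram_labelling) blast
  have "index_partition k (restrict i {1..k}) (restrict j {1..k}) = d"
    unfolding ij(1)[symmetric] by (rule index_partition_cong) simp
  moreover have "restrict i {1..k} \<in> multi_indices n k" "restrict j {1..k} \<in> multi_indices n k"
    using ij(2) by (auto simp: multi_indices_iff)
  ultimately show "d \<in> {index_partition k i j | i j. i \<in> multi_indices n k \<and> j \<in> multi_indices n k}"
    by blast
qed

text \<open>Both extended labellings carry \<open>n\<close> in position \<open>Suc k\<close>, so a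
  permutation taking one to the other must fix \<open>n\<close>. This is how the stabilizer
  enters.\<close>

lemma index_partition_half_orbits:
  assumes "n > 0" "i \<in> multi_indices n k" "j \<in> multi_indices n k"
    "i' \<in> multi_indices n k" "j' \<in> multi_indices n k"
  shows "index_partition (Suc k) (i(Suc k := n)) (j(Suc k := n)) =
      index_partition (Suc k) (i'(Suc k := n)) (j'(Suc k := n)) \<longleftrightarrow>
    (\<exists>\<sigma>\<in>symm_stabilizer n. i' = index_act k \<sigma> i \<and> j' = index_act k \<sigma> j)"
proof -
  have "index_partition (Suc k) (i(Suc k := n)) (j(Suc k := n)) =
      index_partition (Suc k) (i'(Suc k := n)) (j'(Suc k := n)) \<longleftrightarrow>
    (\<exists>\<sigma>\<in>symm_group n. \<forall>r\<in>{1..Suc k}. (i'(Suc k := n)) r = \<sigma> ((i(Suc k := n)) r) \<and>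
      (j'(Suc k := n)) r = \<sigma> ((j(Suc k := n)) r))"
    using assms by (intro index_partition_eq_iff) (auto simp: multi_indices_iff le_Suc_eq)
  also have "\<dots> \<longleftrightarrow> (\<exists>\<sigma>\<in>symm_stabilizer n. (\<forall>r\<in>{1..k}. i' r = \<sigma> (i r)) \<and> (\<forall>r\<in>{1..k}. j' r = \<sigma> (j r)))"
  proof -
    have "(\<forall>r\<in>{1..Suc k}. (i'(Suc k := n)) r = \<sigma> ((i(Suc k := n)) r) \<and>
        (j'(Suc k := n)) r = \<sigma> ((j(Suc k := n)) r)) \<longleftrightarrow>
      \<sigma> n = n \<and> (\<forall>r\<in>{1..k}. i' r = \<sigma> (i r)) \<and> (\<forall>r\<in>{1..k}. j' r = \<sigma> (j r))" for \<sigma>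
      unfolding ball_atLeastAtMost_Suc by (auto simp: eq_commute[of n])
    then show ?thesis unfolding symm_stabilizer_def by blast
  qed
  finally show ?thesis
    unfolding eq_index_act_iff[OF assms(4)] eq_index_act_iff[OF assms(5)] .
qed

text \<open>Equal last labels put \<open>Top (Suc k)\<close> and \<open>Bot (Suc k)\<close> into one
  block. Conversely, a labelling of a half diagram has a common last label, which can be moved to
  \<open>n\<close>.\<close>

lemma index_partition_half_range:
  assumes "n > 0"
  shows "{index_partition (Suc k) (i(Suc k := n)) (j(Suc k := n)) | i j.
      i \<in> multi_indices n k \<and> j \<in> multi_indices n k} = {d \<in> half_diagrams k. \<not> n < card d}"
    (is "?L = ?R")
proof (intro equalityI subsetI)
  fix d assume "d \<in> ?L"
  then obtain i j where d: "d = index_partition (Suc k) (i(Suc k := n)) (j(Suc k := n))"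
    and ij: "i \<in> multi_indices n k" "j \<in> multi_indices n k" by blast
  have "card d \<le> n"
    unfolding d using assms ij
    by (intro card_index_partition_le) (auto simp: multi_indices_iff le_Suc_eq)
  moreover have last: "Top (Suc k) \<in> vertices (Suc k)" "Bot (Suc k) \<in> vertices (Suc k)"
    by (auto simp: vertices_def)
  let ?l = "vertex_label (i(Suc k := n)) (j(Suc k := n))"
  have "{q \<in> vertices (Suc k). ?l q = ?l (Top (Suc k))} \<in> d"
    unfolding d index_partition_def kernel_partition_def using last(1) by (rule imageI)
  with last have "\<exists>B\<in>d. Top (Suc k) \<in> B \<and> Bot (Suc k) \<in> B" by (intro bexI) auto
  ultimately show "d \<in> ?R"
    by (simp add: half_diagrams_def index_partition_mem d not_less)
next
  fix d assume "d \<in> ?R"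
  then have d: "d \<in> diagrams (Suc k)" "card d \<le> n"
    and "\<exists>B\<in>d. Top (Suc k) \<in> B \<and> Bot (Suc k) \<in> B" by (auto simp: half_diagrams_def)
  then obtain B where B: "B \<in> d" "Top (Suc k) \<in> B" "Bot (Suc k) \<in> B" by blast
  obtain i j where ij: "index_partition (Suc k) i j = d"
    "\<And>r. r \<in> {1..Suc k} \<Longrightarrow> i r \<in> {1..n} \<and> j r \<in> {1..n}" using d by (rule diagram_labelling) blast
  have P: "partition_on (vertices (Suc k)) d" using d(1) by (simp add: diagrams_def)
  \<comment> \<open>Since \<open>d\<close> is the kernel partition of the labelling and refines
    itself, the labels are constant on its blocks.\<close>
  have "refines (vertices (Suc k)) d (kernel_partition (vertices (Suc k)) (vertex_label i j))"
    using refines_refl[OF P] ij(1) by (simp add: index_partition_def)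
  then have "\<forall>B\<in>d. \<forall>p\<in>B. \<forall>q\<in>B. vertex_label i j p = vertex_label i j q"
    unfolding refines_kernel_partition_iff[OF P] .
  with B have "vertex_label i j (Bot (Suc k)) = vertex_label i j (Top (Suc k))" by blast
  then have last: "j (Suc k) = i (Suc k)" by simp
  \<comment> \<open>The transposition takes the common last label to \<open>n\<close>; relabelling
    by it leaves the partition unchanged.\<close>
  define \<sigma> where "\<sigma> = transpose (i (Suc k)) n"
  have \<sigma>: "\<sigma> permutes {1..n}"
    unfolding \<sigma>_def using assms ij(2)[of "Suc k"] by (intro permutes_swap_id) auto
  have \<sigma>_mem: "\<sigma> (i r) \<in> {1..n} \<and> \<sigma> (j r) \<in> {1..n}" if "r \<in> {1..k}" for r
    using ij(2)[of r] that permutes_in_image[OF \<sigma>] by auto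
  have "index_partition (Suc k) ((index_act k \<sigma> i)(Suc k := n)) ((index_act k \<sigma> j)(Suc k := n)) =
      index_partition (Suc k) (\<lambda>r. \<sigma> (i r)) (\<lambda>r. \<sigma> (j r))"
    by (intro index_partition_cong) (auto simp: index_act_def last \<sigma>_def le_Suc_eq)
  also have "\<dots> = d" using permutes_inj[OF \<sigma>] by (simp add: index_partition_compose ij(1))
  moreover have "index_act k \<sigma> i \<in> multi_indices n k" "index_act k \<sigma> j \<in> multi_indices n k"
    using \<sigma>_mem by (auto simp: multi_indices_iff index_act_def)
  ultimately show "d \<in> ?L" by blast
qed


section \<open>The operators in coordinates\<close>

lemma perm_act_basis:
  assumes V: "dual_basis sV {1..n} v c"
  shows "lmap sV sV (perm_act sV n v \<sigma>)" and "i \<in> {1..n} \<Longrightarrow> perm_act sV n v \<sigma> (v i) = v (\<sigma> i)"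
proof -
  interpret V: dual_basis sV "{1..n}" v c by fact
  show "lmap sV sV (perm_act sV n v \<sigma>)" "i \<in> {1..n} \<Longrightarrow> perm_act sV n v \<sigma> (v i) = v (\<sigma> i)"
    using theI'[OF V.ex1_linear[OF V.vector_space_axioms, of "\<lambda>i. v (\<sigma> i)"]]
    unfolding perm_act_def by blast+
qed

lemma tensor_act_basis:
  assumes V: "dual_basis sV {1..n} v c"
    and W: "dual_basis sW (multi_indices n k) (\<lambda>i. t (\<lambda>r. v (i r))) C"
    and T: "tensor_power sV k sW t"
  shows "lmap sW sW (tensor_act sV n v sW t \<sigma>)"
    and "i \<in> multi_indices n k \<Longrightarrow>
      tensor_act sV n v sW t \<sigma> (t (\<lambda>r. v (i r))) = t (\<lambda>r. v (index_act k \<sigma> i r))"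
proof -
  have mult: "multilinear sV k sW t" and "vector_space sW" using T by (auto simp: tensor_power_def)
  have *: "lmap sW sW (tensor_act sV n v sW t \<sigma>) \<and>
      (\<forall>u. tensor_act sV n v sW t \<sigma> (t u) = t (\<lambda>r. perm_act sV n v \<sigma> (u r)))"
    unfolding tensor_act_def
    by (rule theI'[OF tensor_power_ex1[OF V W T \<open>vector_space sW\<close>
          multilinear_map_args[OF mult perm_act_basis(1)[OF V]]]])
  then show "lmap sW sW (tensor_act sV n v sW t \<sigma>)" by blast
  assume i: "i \<in> multi_indices n k"
  have "tensor_act sV n v sW t \<sigma> (t (\<lambda>r. v (i r))) = t (\<lambda>r. perm_act sV n v \<sigma> (v (i r)))"
    using * by blast
  \<comment> \<open>The two tuples may differ outside \<open>{1..k}\<close>, where \<open>t\<close>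
    ignores them.\<close>
  also have "\<dots> = t (\<lambda>r. v (index_act k \<sigma> i r))"
    using i by (intro multilinear_cong[OF mult])
      (simp add: perm_act_basis(2)[OF V] multi_indices_iff index_act_def)
  finally show "tensor_act sV n v sW t \<sigma> (t (\<lambda>r. v (i r))) = t (\<lambda>r. v (index_act k \<sigma> i r))" .
qed

lemma Phi_diagram_operator:
  assumes W: "dual_basis sW (multi_indices n k) (\<lambda>i. t (\<lambda>r. v (i r))) C"
  shows "Phi_diagram n v k sW t d =
    dual_basis.operator sW (multi_indices n k) (\<lambda>i. t (\<lambda>r. v (i r))) (diagram_entry d)"
  unfolding Phi_diagram_def dual_basis.operator_def[OF W] ..

lemma multi_indices_extend_last:
  assumes "n > 0"
  shows "bij_betw (\<lambda>j. j(Suc k := n)) (multi_indices n k) {j \<in> multi_indices n (Suc k). j (Suc k) = n}"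
proof (rule bij_betwI)
  show "(\<lambda>j. j(Suc k := n)) \<in> multi_indices n k \<rightarrow> {j \<in> multi_indices n (Suc k). j (Suc k) = n}"
    using assms by (auto simp: multi_indices_iff extensional_def le_Suc_eq)
  \<comment> \<open>An extensional function on \<open>{1..k}\<close> is \<open>undefined\<close> at
    \<open>Suc k\<close>, so this reverses the extension.\<close>
  show "(\<lambda>j. j(Suc k := undefined)) \<in> {j \<in> multi_indices n (Suc k). j (Suc k) = n} \<rightarrow> multi_indices n k"
    by (auto simp: multi_indices_iff extensional_def)
  show "(j(Suc k := n))(Suc k := undefined) = j" if "j \<in> multi_indices n k" for j
    using that by (auto simp: multi_indices_iff extensional_def fun_eq_iff)
qed auto

text \<open>The map \<open>?h\<close>, tensoring with \<open>v n\<close>, takes basis tensors to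
  basis tensors, and the operator of \<open>d\<close> preserves its range. Restriction therefore
  cuts out the submatrix of the indices ending in \<open>n\<close>.\<close>

lemma Phi_half_diagram_operator:
  assumes n: "n > 0" and V: "dual_basis sV {1..n} v c"
    and W: "dual_basis sW (multi_indices n k) (\<lambda>i. tW (\<lambda>r. v (i r))) C"
    and TW: "tensor_power sV k sW tW" and TZ: "tensor_power sV (Suc k) sZ tZ"
    and d: "d \<in> half_diagrams k"
  shows "Phi_half_diagram n v k sW tW sZ tZ d =
    dual_basis.operator sW (multi_indices n k) (\<lambda>i. tW (\<lambda>r. v (i r)))
      (\<lambda>i j. diagram_entry d (i(Suc k := n)) (j(Suc k := n)))"
proof -
  let ?I = "multi_indices n k" and ?J = "multi_indices n (Suc k)"
  let ?eW = "\<lambda>i. tW (\<lambda>r. v (i r))" and ?eZ = "\<lambda>i. tZ (\<lambda>r. v (i r))"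
  let ?x = "\<lambda>i. i(Suc k := n)" and ?h = "tensor_last n v k sW tW sZ tZ"
  interpret W: dual_basis sW ?I ?eW C by (rule W)
  obtain CZ where "dual_basis sZ ?J ?eZ CZ" by (rule tensor_power_dual_basis[OF V TZ])
  then interpret Z: dual_basis sZ ?J ?eZ CZ .
  note x = multi_indices_extend_last[OF n, of k]
  have xJ: "?x i \<in> ?J" if "i \<in> ?I" for i using bij_betw_apply[OF x that] by simp
  have x_eq: "?x i = ?x j \<longleftrightarrow> i = j" if "i \<in> ?I" "j \<in> ?I" for i j
    using bij_betw_imp_inj_on[OF x] that by (rule inj_on_eq_iff)
  have "multilinear sV k sZ (\<lambda>u. tZ (u(Suc k := v n)))"
    using TZ by (intro multilinear_fix_last) (simp add: tensor_power_def)
  from theI'[OF tensor_power_ex1[OF V W TW Z.vector_space_axioms this]]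
  have h: "lmap sW sZ ?h" and h_t: "?h (tW u) = tZ (u(Suc k := v n))" for u
    unfolding tensor_last_def by blast+
  have h_e: "?h (?eW i) = ?eZ (?x i)" for i
    unfolding h_t by (rule arg_cong[of _ _ tZ]) auto
  \<comment> \<open>The coordinates of \<open>w\<close> can be read off those of
    \<open>?h w\<close>, which yields injectivity of \<open>?h\<close>.\<close>
  have coord_h: "CZ (?x i) (?h w) = C i w" if "i \<in> ?I" for i w
  proof -
    have "CZ (?x i) \<circ> ?h = C i"
    proof (rule W.linear_eqI[of "(*)"])
      show "lmap sW (*) (CZ (?x i) \<circ> ?h)"
        by (rule Vector_Spaces.linear_compose[OF h Z.coord_linear[OF xJ[OF that]]])
      show "lmap sW (*) (C i)" using that by (rule W.coord_linear)
      show "(CZ (?x i) \<circ> ?h) (?eW j) = C i (?eW j)" if "j \<in> ?I" for j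
        using \<open>i \<in> ?I\<close> that unfolding o_apply h_e
        by (simp only: Z.coord_basis xJ W.coord_basis x_eq)
    qed
    then show ?thesis by (metis o_apply)
  qed
  have "inj ?h"
  proof (rule injI)
    fix w w' assume "?h w = ?h w'"
    then have "(\<Sum>i\<in>?I. sW (C i w) (?eW i)) = (\<Sum>i\<in>?I. sW (C i w') (?eW i))"
      by (intro sum.cong refl) (simp flip: coord_h)
    then show "w = w'" by (simp only: W.expansion)
  qed
  let ?M = "\<lambda>i j. diagram_entry d (?x i) (?x j)"
  interpret h: Vector_Spaces.linear sW sZ ?h by (rule h)
  \<comment> \<open>The block joining the last two vertices forces the last lower label to equal the
    last upper one, which is \<open>n\<close>.\<close>
  have entry_0: "diagram_entry d (?x i) j = 0" if "j (Suc k) \<noteq> n" for i j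
  proof -
    obtain B where "B \<in> d" "Top (Suc k) \<in> B" "Bot (Suc k) \<in> B"
      using d by (auto simp: half_diagrams_def)
    moreover have "vertex_label (?x i) j (Top (Suc k)) \<noteq> vertex_label (?x i) j (Bot (Suc k))"
      using that by simp
    ultimately show ?thesis unfolding diagram_entry_def by meson
  qed
  \<comment> \<open>\<open>?h\<close> intertwines the two operators, so the \<open>inv_into\<close>
    in \<open>Phi_half_diagram\<close> is applied only within the range of \<open>?h\<close>, where
    it cancels.\<close>
  have "Z.operator (diagram_entry d) \<circ> ?h = ?h \<circ> W.operator ?M"
  proof (rule W.linear_eqI[of sZ])
    show "lmap sW sZ (Z.operator (diagram_entry d) \<circ> ?h)"
      by (rule Vector_Spaces.linear_compose[OF h Z.operator_linear])
    show "lmap sW sZ (?h \<circ> W.operator ?M)"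
      by (rule Vector_Spaces.linear_compose[OF W.operator_linear h])
    fix i assume i: "i \<in> ?I"
    have "(Z.operator (diagram_entry d) \<circ> ?h) (?eW i) =
        (\<Sum>j\<in>?J. sZ (diagram_entry d (?x i) j) (?eZ j))"
      unfolding o_apply h_e by (rule Z.operator_basis[OF xJ[OF i]])
    also have "\<dots> = (\<Sum>j\<in>{j\<in>?J. j (Suc k) = n}. sZ (diagram_entry d (?x i) j) (?eZ j))"
      using Z.finite_index by (intro sum.mono_neutral_right) (auto simp: entry_0)
    also have "\<dots> = (\<Sum>j\<in>?I. sZ (?M i j) (?eZ (?x j)))"
      by (rule sum.reindex_bij_betw[OF x, symmetric])
    also have "\<dots> = (?h \<circ> W.operator ?M) (?eW i)"
      unfolding o_apply W.operator_basis[OF i] h.sum h.scale h_e ..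
    finally show "(Z.operator (diagram_entry d) \<circ> ?h) (?eW i) = (?h \<circ> W.operator ?M) (?eW i)" .
  qed
  then have "Phi_half_diagram n v k sW tW sZ tZ d = inv_into UNIV ?h \<circ> (?h \<circ> W.operator ?M)"
    unfolding Phi_half_diagram_def Phi_diagram_operator[OF Z.dual_basis_axioms] comp_assoc by simp
  then show ?thesis using \<open>inj ?h\<close> by (simp add: o_assoc)
qed

theorem theorem3p6:
  fixes n k :: nat
    and sV :: "complex \<Rightarrow> 'v \<Rightarrow> 'v::ab_group_add"
    and v :: "nat \<Rightarrow> 'v"
    and sW :: "complex \<Rightarrow> 'w \<Rightarrow> 'w::ab_group_add"
    and tW :: "(nat \<Rightarrow> 'v) \<Rightarrow> 'w"
    and sZ :: "complex \<Rightarrow> 'z \<Rightarrow> 'z::ab_group_add"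
    and tZ :: "(nat \<Rightarrow> 'v) \<Rightarrow> 'z"
  assumes "n > 0"
    and "vector_space sV"
    and "is_basis sV n v"
    and "tensor_power sV k sW tW"
    and "tensor_power sV (Suc k) sZ tZ"
  shows
    "(Phi n v k sW tW ` carrier (partition_algebra k n)
        = End_group sV n v sW tW (symm_group n) \<and>
      kernel_on (Phi n v k sW tW) (partition_algebra k n)
        = lspan (smult (partition_algebra k n))
            (orbit_element k (diagrams k) ` {d \<in> diagrams k. card d > n})) \<and>
     (Phi_half n v k sW tW sZ tZ ` carrier (half_partition_algebra k n)
        = End_group sV n v sW tW (symm_stabilizer n) \<and>
      kernel_on (Phi_half n v k sW tW sZ tZ) (half_partition_algebra k n)
        = lspan (smult (half_partition_algebra k n))
            (orbit_element (Suc k) (half_diagrams k) ` {d \<in> half_diagrams k. card d > n}))"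
proof -
  obtain c where V: "dual_basis sV {1..n} v c"
    by (rule is_basis_dual_basis[OF assms(2,3)])
  obtain C where W: "dual_basis sW (multi_indices n k) (\<lambda>i. tW (\<lambda>r. v (i r))) C"
    by (rule tensor_power_dual_basis[OF V assms(4)])
  interpret W: dual_basis sW "multi_indices n k" "\<lambda>i. tW (\<lambda>r. v (i r))" C by (rule W)
  note act = tensor_act_basis[OF V W assms(4)]
  have stab: "\<sigma> \<in> symm_group n" if "\<sigma> \<in> symm_stabilizer n" for \<sigma>
    using that by (simp add: symm_stabilizer_def)
  have Phi: "Phi n v k sW tW a = (\<lambda>w. \<Sum>d\<in>diagrams k. sW (a d) (W.operator
      (\<lambda>i j. if refines (vertices k) d (index_partition k i j) then 1 else 0) w))" for a
    unfolding Phi_def Phi_diagram_operator[OF W]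
    by (intro ext sum.cong refl) (simp add: diagram_entry_refines)
  \<comment> \<open>The operators still act on the \<open>k\<close>-th tensor power, but the
    diagrams have \<open>Suc k\<close> columns: \<open>\<kappa>\<close> is now the partition given
    by both indices extended by \<open>n\<close>.\<close>
  have Phi_half: "Phi_half n v k sW tW sZ tZ a = (\<lambda>w. \<Sum>d\<in>half_diagrams k. sW (a d) (W.operator
      (\<lambda>i j. if refines (vertices (Suc k)) d (index_partition (Suc k) (i(Suc k := n)) (j(Suc k := n)))
        then 1 else 0) w))" for a
    unfolding Phi_half_def
    by (intro ext sum.cong refl)
      (simp add: Phi_half_diagram_operator[OF assms(1) V W assms(4,5)]
        diagram_entry_refines[OF half_diagrams_subset[THEN subsetD]])
  note half_range = index_partition_half_range[OF assms(1)]
    and half_orbits = index_partition_half_orbits[OF assms(1)]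
  show ?thesis
    unfolding partition_algebra_def half_partition_algebra_def End_group_def
  proof (intro conjI)
    show "Phi n v k sW tW ` carrier (diagram_algebra k (diagrams k) n) = {f. lmap sW sW f \<and>
        (\<forall>\<sigma>\<in>symm_group n. f \<circ> tensor_act sV n v sW tW \<sigma> = tensor_act sV n v sW tW \<sigma> \<circ> f)}"
      by (rule diagram_action_image[OF W order_refl Phi index_partition_range, where p = "index_act k"])
        (assumption | rule act index_act_bij index_partition_orbits)+
    show "kernel_on (Phi n v k sW tW) (diagram_algebra k (diagrams k) n) =
        lspan (smult (diagram_algebra k (diagrams k) n))
          (orbit_element k (diagrams k) ` {d \<in> diagrams k. n < card d})"
      by (rule diagram_action_kernel[OF W order_refl Phi index_partition_range,
            where p = "index_act k" and act = "tensor_act sV n v sW tW" and G = "symm_group n"])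
        (assumption | rule act index_act_bij index_partition_orbits)+
    show "Phi_half n v k sW tW sZ tZ ` carrier (diagram_algebra (Suc k) (half_diagrams k) n) =
        {f. lmap sW sW f \<and> (\<forall>\<sigma>\<in>symm_stabilizer n.
          f \<circ> tensor_act sV n v sW tW \<sigma> = tensor_act sV n v sW tW \<sigma> \<circ> f)}"
      by (rule diagram_action_image[OF W half_diagrams_subset Phi_half half_range, where p = "index_act k"])
        (assumption | rule act index_act_bij stab half_orbits)+
    show "kernel_on (Phi_half n v k sW tW sZ tZ) (diagram_algebra (Suc k) (half_diagrams k) n) =
        lspan (smult (diagram_algebra (Suc k) (half_diagrams k) n))
          (orbit_element (Suc k) (half_diagrams k) ` {d \<in> half_diagrams k. n < card d})"
      by (rule diagram_action_kernel[OF W half_diagrams_subset Phi_half half_range,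
            where p = "index_act k" and act = "tensor_act sV n v sW tW" and G = "symm_stabilizer n"])
        (assumption | rule act index_act_bij stab half_orbits)+
  qed
qed

end
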